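(* Let $X$ be an Archimedean vector lattice with Dedekind completion $X^\delta$. The following are equivalent: (i) $X$ is strongly first countable; (ii) there exist $\{a_n\}_{n\in\mathbb N},\{b_n\}_{n\in\mathbb N}\subseteq X_+$ such that $X_+\setminus\{0\}=\bigcup_{n\in\mathbb N}[a_n,b_n]$; (iii) there exists an increasing sequence $(v_n)$ in $X_+$ such that $X=I_{\{v_n\}}$, and the Boolean algebra $\mathcal B_X$ of all bands in $X$ has a countable $\pi$-base; (iv) there exist $\{a_n\}_{n\in\mathbb N},\{b_n\}_{n\in\mathbb N}\subseteq X^\delta_+$ such that $X^\delta_+\setminus\{0\}=\bigcup_{n\in\mathbb N}[a_n,b_n]$; (v) there exists an increasing sequence $(v_n)$ in $X^\delta_+$ such that $X^\delta=I_{\{v_n\}}$ (the ideal being taken in $X^\delta$), and the Boolean algebra $C_{v_n}$ of components of $v_n$ in $X^\delta$ has a countable $\pi$-base for every $n\in\mathbb N$.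
   Context: Nets are indexed by pre-ordered upward directed sets. The tail filter $[x_\alpha]$ of a net consists of all sets containing some tail $\{x_\alpha:\alpha\ge\alpha_0\}$; a filter $\mathcal F$ converges to $x$ if $\mathcal F=[x_\alpha]$ for some net $x_\alpha\to x$. For a filter base $\mathcal B$, $[\mathcal B]$ is the filter it generates. A convergence structure is strongly first countable if for every $x$ there is a countable collection $\mathcal H$ of subsets such that whenever a filter $\mathcal F\to x$ there is a filter base $\mathcal B\subseteq\mathcal F\cap\mathcal H$ with $[\mathcal B]\to x$. Order convergence: $x_\alpha\xrightarrow{\mathrm{o}}x$ if there is a set $D$ with $\bigwedge D=0$ such that for every $d\in D$ there is $\alpha_d$ with $|x_\alpha-x|\le d$ for all $\alpha\ge\alpha_d$. $X$ is called strongly first countable if order convergence on $X$ is strongly first countable. $I_A$ is the ideal (solid linear subspace) generated by $A$; $I_{\{v_n\}}$ is the ideal generated by the set $\{v_n:n\in\mathbb N\}$. $[a,b]$ is an order interval. A vector $x\ge0$ is a component of $y\ge 0$ if $x\wedge(y-x)=0$; the components of $y$ form a Boolean algebra $C_y$. The bands of $X$ form a complete Boolean algebra $\mathcal B_X$ under inclusion. A $\pi$-base of a Boolean algebra $B$ is a set $A\subseteq B\setminus\{0\}$ such that for every $b>0$ there is $a\in A$ with $0<a\le b$.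
   Formalization: The vector lattice X is assumed to be nonzero; for X = {0} conditions (i), (iii), (v) hold while (ii) and (iv) fail, because the positive nonzero part is empty but every interval [0,0] = {0} is not. *)

theory Defs
  imports Complex_Main "HOL-Library.Countable_Set" "HOL-Library.Lattice_Algebras" "HOL-Library.Lub_Glb"
begin

section \<open>Vector lattices\<close>

class vector_lattice = ordered_real_vector + lattice_ab_group_add_abs

class archimedean_vector_lattice = vector_lattice +
  assumes archimedean: "(\<And>n::nat. 0 < n \<Longrightarrow> of_nat n *\<^sub>R x \<le> y) \<Longrightarrow> x \<le> 0"

class dedekind_complete_vector_lattice = vector_lattice + conditionally_complete_lattice

instance real :: lattice_ab_group_add_abs
  by standard (simp add: sup_real_def max_def abs_if)

instance real :: archimedean_vector_lattice
proof
  fix x y :: real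
  assume le: "\<And>n::nat. 0 < n \<Longrightarrow> of_nat n *\<^sub>R x \<le> y"
  show "x \<le> 0"
  proof (rule ccontr)
    assume "\<not> x \<le> 0"
    then obtain n :: nat where "y < of_nat n * x"
      using reals_Archimedean3[of x] by (meson not_le)
    moreover have "of_nat n * x \<le> of_nat (Suc n) * x"
      using \<open>\<not> x \<le> 0\<close> by (intro mult_right_mono) auto
    moreover have "of_nat (Suc n) * x \<le> y"
      using le[of "Suc n"] unfolding real_scaleR_def by blast
    ultimately show False
      by linarith
  qed
qed

instance real :: dedekind_complete_vector_lattice ..

text \<open>
  The Dedekind completion is represented by its characterisation, which determines it up to
  isomorphism: a Dedekind complete vector lattice together with an embedding whose range is
  an order dense and majorizing vector sublattice.
\<close>

definition dedekind_completion ::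
    "('a::vector_lattice \<Rightarrow> 'b::dedekind_complete_vector_lattice) \<Rightarrow> bool" where
  "dedekind_completion J \<longleftrightarrow>
     linear J \<and> inj J \<and>
     (\<forall>x y. J (sup x y) = sup (J x) (J y)) \<and>
     (\<forall>x y. J (inf x y) = inf (J x) (J y)) \<and>
     (\<forall>y>0. \<exists>x>0. J x \<le> y) \<and>
     (\<forall>y. \<exists>x. y \<le> J x)"

definition riesz_ideal :: "'a::vector_lattice set \<Rightarrow> bool" where
  "riesz_ideal S \<longleftrightarrow> subspace S \<and> (\<forall>x\<in>S. \<forall>y. \<bar>y\<bar> \<le> \<bar>x\<bar> \<longrightarrow> y \<in> S)"

definition ideal_generated :: "'a::vector_lattice set \<Rightarrow> 'a set" where
  "ideal_generated A = riesz_ideal hull A"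

definition band :: "'a::vector_lattice set \<Rightarrow> bool" where
  "band S \<longleftrightarrow> riesz_ideal S \<and> (\<forall>A s. A \<subseteq> S \<and> isLub UNIV A s \<longrightarrow> s \<in> S)"

definition components :: "'a::vector_lattice \<Rightarrow> 'a set" where
  "components y = {x. 0 \<le> x \<and> inf x (y - x) = 0}"

text \<open>
  A Boolean algebra enters this notion only through its underlying ordered set \<open>B\<close>
  (ordered as a subset of the ambient type) and its least element \<open>z\<close>.
\<close>

definition pi_base :: "'c::order set \<Rightarrow> 'c \<Rightarrow> 'c set \<Rightarrow> bool" where
  "pi_base B z A \<longleftrightarrow> A \<subseteq> B - {z} \<and> (\<forall>b\<in>B. z < b \<longrightarrow> (\<exists>a\<in>A. z < a \<and> a \<le> b))"

definition has_countable_pi_base :: "'c::order set \<Rightarrow> 'c \<Rightarrow> bool" where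
  "has_countable_pi_base B z \<longleftrightarrow> (\<exists>A. countable A \<and> pi_base B z A)"

lemma least_band:
  fixes S :: "'a::vector_lattice set"
  shows "band {0::'a}" "band S \<Longrightarrow> {0} \<subseteq> S"
proof -
  have "s = 0" if "A \<subseteq> {0}" and s: "isLub UNIV A s" for A and s :: 'a
  proof -
    have "s \<le> 0"
      using that by (auto simp: isLub_def leastP_def isUb_def setle_def setge_def)
    moreover have "0 \<le> s"
    proof (cases "A = {}")
      case True
      then have "s \<le> u" for u
        using s by (auto simp: isLub_def leastP_def isUb_def setle_def setge_def)
      from this[of "s + s"] show ?thesis
        by simp
    next
      case False
      then have "0 \<in> A"
        using that by auto
      then show ?thesis
        using s by (auto simp: isLub_def leastP_def isUb_def setle_def)
    qed
    ultimately show ?thesis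
      by (rule antisym)
  qed
  moreover have "riesz_ideal {0::'a}"
    by (simp add: riesz_ideal_def)
  ultimately show "band {0::'a}"
    unfolding band_def by blast
  show "band S \<Longrightarrow> {0} \<subseteq> S"
    by (simp add: band_def riesz_ideal_def subspace_0)
qed

section \<open>Nets and filters\<close>

definition upward_directed :: "'i set \<Rightarrow> 'i rel \<Rightarrow> bool" where
  "upward_directed I r \<longleftrightarrow>
     preorder_on I r \<and> I \<noteq> {} \<and> (\<forall>a\<in>I. \<forall>b\<in>I. \<exists>c\<in>I. (a, c) \<in> r \<and> (b, c) \<in> r)"

definition tail_filter :: "'i set \<Rightarrow> 'i rel \<Rightarrow> ('i \<Rightarrow> 'a) \<Rightarrow> 'a filter" where
  "tail_filter I r x = (INF a\<in>I. principal (x ` (r `` {a})))"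

lemma eventually_tail_filter:
  assumes "upward_directed I r"
  shows "eventually P (tail_filter I r x) \<longleftrightarrow> (\<exists>a\<in>I. \<forall>b. (a, b) \<in> r \<longrightarrow> P (x b))"
proof -
  have trans: "trans r"
    using assms by (simp add: upward_directed_def preorder_on_def)
  have "\<exists>c\<in>I. principal (x ` (r `` {c})) \<le> inf (principal (x ` (r `` {a}))) (principal (x ` (r `` {b})))"
    if ab: "a \<in> I" "b \<in> I" for a b
  proof -
    obtain c where "c \<in> I" "(a, c) \<in> r" "(b, c) \<in> r"
      using assms ab unfolding upward_directed_def by meson
    then have "r `` {c} \<subseteq> r `` {a} \<inter> r `` {b}"
      using trans by (blast dest: transD)
    then have "x ` (r `` {c}) \<subseteq> x ` (r `` {a}) \<inter> x ` (r `` {b})"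
      by blast
    with \<open>c \<in> I\<close> show ?thesis
      by (intro bexI[of _ c]) (simp_all only: inf_principal principal_le_iff)
  qed
  moreover have "I \<noteq> {}"
    using assms by (simp add: upward_directed_def)
  ultimately have "eventually P (tail_filter I r x) \<longleftrightarrow>
      (\<exists>a\<in>I. eventually P (principal (x ` (r `` {a}))))"
    unfolding tail_filter_def by (intro eventually_INF_base) blast+
  moreover have "eventually P (principal (x ` (r `` {a}))) \<longleftrightarrow> (\<forall>b. (a, b) \<in> r \<longrightarrow> P (x b))" for a
    unfolding eventually_principal by blast
  ultimately show ?thesis
    by simp
qed

definition net_order_conv :: "'i set \<Rightarrow> 'i rel \<Rightarrow> ('i \<Rightarrow> 'a::vector_lattice) \<Rightarrow> 'a \<Rightarrow> bool" where
  "net_order_conv I r x l \<longleftrightarrow>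
     (\<exists>D. isGlb UNIV D 0 \<and>
          (\<forall>d\<in>D. \<exists>a\<in>I. \<forall>b. (a, b) \<in> r \<longrightarrow> \<bar>x b - l\<bar> \<le> d))"

text \<open>
  HOL cannot quantify existentially over the type of indices, so the index sets range over
  subsets of one fixed, sufficiently large type. The lemma \<open>filter_order_convI\<close> shows
  that nets indexed by any other type yield no further convergent filters.
\<close>

definition filter_order_conv :: "'a::vector_lattice filter \<Rightarrow> 'a \<Rightarrow> bool" where
  "filter_order_conv F l \<longleftrightarrow>
     (\<exists>(I :: ('a \<times> 'a set) set) r x.
        upward_directed I r \<and> F = tail_filter I r x \<and> net_order_conv I r x l)"

lemma filter_order_convI:
  fixes I :: "'i set" and x :: "'i \<Rightarrow> 'a::vector_lattice"
  assumes dir: "upward_directed I r" and conv: "net_order_conv I r x l"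
  shows "filter_order_conv (tail_filter I r x) l"
proof -
  define F where "F = tail_filter I r x"
  define K where "K = {(y, S). y \<in> S \<and> eventually (\<lambda>z. z \<in> S) F}"
  define q where "q = {(p, p'). p \<in> K \<and> p' \<in> K \<and> snd p' \<subseteq> snd p}"
  have nonempty: "\<exists>z. z \<in> S" if "eventually (\<lambda>z. z \<in> S) F" for S
  proof -
    obtain a where "a \<in> I" and a: "\<forall>b. (a, b) \<in> r \<longrightarrow> x b \<in> S"
      using \<open>eventually (\<lambda>z. z \<in> S) F\<close> unfolding F_def eventually_tail_filter[OF dir] by blast
    moreover have "refl_on I r"
      using dir by (simp add: upward_directed_def preorder_on_def)
    ultimately show ?thesis
      by (blast dest: refl_onD)
  qed
  have dirK: "upward_directed K q"
    unfolding upward_directed_def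
  proof (intro conjI ballI)
    show "preorder_on K q"
      by (auto simp: preorder_on_def q_def refl_on_def trans_def)
    have "(undefined, UNIV) \<in> K"
      by (auto simp: K_def)
    then show "K \<noteq> {}"
      by blast
  next
    fix p p' assume p: "p \<in> K" "p' \<in> K"
    then have ev: "eventually (\<lambda>z. z \<in> snd p \<inter> snd p') F"
      by (auto simp: K_def eventually_conj_iff)
    then obtain z where "z \<in> snd p \<inter> snd p'"
      using nonempty by blast
    then have "(z, snd p \<inter> snd p') \<in> K"
      using ev by (auto simp: K_def)
    then show "\<exists>c\<in>K. (p, c) \<in> q \<and> (p', c) \<in> q"
      using p by (intro bexI[of _ "(z, snd p \<inter> snd p')"]) (auto simp: q_def)
  qed
  have tail: "(\<exists>a\<in>K. \<forall>b. (a, b) \<in> q \<longrightarrow> P (fst b)) \<longleftrightarrow> eventually P F" for P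
  proof
    assume "\<exists>a\<in>K. \<forall>b. (a, b) \<in> q \<longrightarrow> P (fst b)"
    then obtain y S where S: "(y, S) \<in> K" and P: "\<forall>b. ((y, S), b) \<in> q \<longrightarrow> P (fst b)"
      by auto
    have "P z" if "z \<in> S" for z
      using P[rule_format, of "(z, S)"] S that by (auto simp: q_def K_def)
    with S show "eventually P F"
      by (auto simp: K_def elim: eventually_mono)
  next
    assume P: "eventually P F"
    then obtain y where y: "P y"
      using nonempty[of "Collect P"] by auto
    then have "(y, Collect P) \<in> K"
      using P by (auto simp: K_def)
    then show "\<exists>a\<in>K. \<forall>b. (a, b) \<in> q \<longrightarrow> P (fst b)"
      by (intro bexI[of _ "(y, Collect P)"]) (auto simp: q_def K_def)
  qed
  have "F = tail_filter K q fst"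
    unfolding filter_eq_iff eventually_tail_filter[OF dirK] tail by simp
  moreover have "(\<exists>a\<in>K. \<forall>b. (a, b) \<in> q \<longrightarrow> \<bar>fst b - l\<bar> \<le> d) \<longleftrightarrow>
      (\<exists>a\<in>I. \<forall>b. (a, b) \<in> r \<longrightarrow> \<bar>x b - l\<bar> \<le> d)" for d
    unfolding tail[of "\<lambda>z. \<bar>z - l\<bar> \<le> d"] F_def eventually_tail_filter[OF dir] ..
  then have "net_order_conv K q fst l"
    using conv unfolding net_order_conv_def by simp
  ultimately show ?thesis
    using dirK unfolding filter_order_conv_def F_def by blast
qed

definition filter_base :: "'a set set \<Rightarrow> bool" where
  "filter_base B \<longleftrightarrow> B \<noteq> {} \<and> {} \<notin> B \<and> (\<forall>S\<in>B. \<forall>T\<in>B. \<exists>U\<in>B. U \<subseteq> S \<inter> T)"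

definition filter_generated :: "'a set set \<Rightarrow> 'a filter" where
  "filter_generated B = (INF S\<in>B. principal S)"

definition strongly_first_countable :: "('a filter \<Rightarrow> 'a \<Rightarrow> bool) \<Rightarrow> bool" where
  "strongly_first_countable conv \<longleftrightarrow>
     (\<forall>x. \<exists>H. countable H \<and>
        (\<forall>F. conv F x \<longrightarrow>
           (\<exists>B. filter_base B \<and> B \<subseteq> {S. eventually (\<lambda>y. y \<in> S) F} \<inter> H \<and>
                conv (filter_generated B) x)))"

end

theory Submission
  imports Defs
begin

text \<open>
  Condition (ii) says that \<open>X\<close> has a countable coinitial subset of its nonzero positive elements and a
  countable majorizing set. Given such sets \<open>A\<close> and \<open>B\<close>, the intervals with radii \<open>b - k a\<close> (and finite
  infima of these) witness strong first countability, because \<open>b - d\<close> is the supremum of the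
  multiples \<open>k a\<close> below it.

  Conversely, a countable family witnessing strong first countability at \<open>0\<close> yields a countable set \<open>Q\<close> in the
  completion such that whenever \<open>E\<close> decreases to \<open>0\<close>, the members of \<open>Q\<close> dominating some element
  of \<open>E\<close> have infimum \<open>0\<close>. Fixing \<open>u\<close>, let \<open>A\<close> consist of the components of \<open>u\<close> generated by
  \<open>(u - q)\<^sup>+\<close>. The set \<open>A\<close> need not be a \<open>\<pi>\<close>-base, but below a dense set of components \<open>y\<close> the
  traces \<open>inf a y\<close> form one, and disjoint families of components are countable; a
  maximal disjoint family of such \<open>y\<close> therefore gives a countable \<open>\<pi>\<close>-base.
\<close>

section \<open>Vector lattices\<close>

context lattice_ab_group_add
begin

text \<open>Addition distributes over \<open>inf\<close>, so the right-hand side is the infimum of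
  \<open>x + x\<close>, \<open>y + x\<close>, \<open>x + z\<close> and \<open>y + z\<close>, each of
  which dominates the left-hand side.\<close>

lemma inf_add_le:
  assumes "0 \<le> x" "0 \<le> y" "0 \<le> z"
  shows "inf x (y + z) \<le> inf x y + inf x z"
proof -
  have "inf x (y + z) \<le> x + x" "inf x (y + z) \<le> y + x"
    "inf x (y + z) \<le> x + z" "inf x (y + z) \<le> y + z"
    using assms by (auto intro: le_infI1 le_infI2 add_increasing add_increasing2)
  then show ?thesis
    by (simp add: add_sup_inf_distribs)
qed

lemma inf_add_eq_0:
  assumes "0 \<le> x" "0 \<le> y" "0 \<le> z" "inf x y = 0" "inf x z = 0"
  shows "inf x (y + z) = 0"
  using inf_add_le[OF assms(1-3)] assms by (intro order.antisym) auto

lemma add_eq_sup_of_inf_eq_0: "inf x y = 0 \<Longrightarrow> x + y = sup x y"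
  using add_eq_inf_sup[of x y] by simp

lemma inf_eq_0_mono:
  assumes "inf x y = 0" "0 \<le> x'" "x' \<le> x" "0 \<le> y'" "y' \<le> y"
  shows "inf x' y' = 0"
  using inf_mono[of x' x y' y] assms by (intro order.antisym) auto

lemma pprt_le_iff: "pprt x \<le> y \<longleftrightarrow> x \<le> y \<and> 0 \<le> y"
  by (simp add: pprt_def)

lemma le_pprt: "x \<le> pprt x"
  by (simp add: pprt_def)

lemma pprt_pos_iff: "0 < pprt x \<longleftrightarrow> \<not> x \<le> 0"
  by (metis le_zero_iff_zero_pprt less_le zero_le_pprt)

lemma pprt_diff_pos_iff: "0 < pprt (x - y) \<longleftrightarrow> \<not> x \<le> y"
  by (simp add: pprt_pos_iff)

lemma pprt_diff_eq: "pprt (x - y) = sup x y - y"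
  using add_sup_distrib_right[of x y "- y"] by (simp add: pprt_def)

lemma pprt_diff_le: "0 \<le> x \<Longrightarrow> 0 \<le> y \<Longrightarrow> pprt (x - y) \<le> x"
  by (simp add: pprt_le_iff diff_le_eq)

text \<open>Since \<open>x = pprt x + nprt x\<close> and \<open>nprt x = - pprt (- x)\<close>, the
  two arguments are \<open>pprt (- x)\<close> plus \<open>x\<close> and plus \<open>0\<close>; their
  infimum is \<open>pprt (- x) + nprt x\<close>.\<close>

lemma pprt_inf_pprt_neg: "inf (pprt x) (pprt (- x)) = 0"
proof -
  have "inf (pprt x) (pprt (- x)) = inf (pprt (- x) + x) (pprt (- x) + 0)"
    using arg_cong[OF prts[of x], of "\<lambda>y. y - nprt x"]
    by (simp only: pprt_neg add_0_right uminus_add_conv_diff add_diff_cancel_right')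
  also have "\<dots> = pprt (- x) + nprt x"
    by (simp only: nprt_def add_inf_distrib_left)
  finally show ?thesis
    by (simp add: pprt_neg)
qed

lemma inf_pprt_diff: "inf (pprt (x - y)) (pprt (y - x)) = 0"
  using pprt_inf_pprt_neg[of "x - y"] by simp

end

section \<open>Infima equal to zero, multiples and the Archimedean property\<close>

lemma isGlb_0_iff:
  "isGlb UNIV D (0::'a::vector_lattice) \<longleftrightarrow>
     (\<forall>d\<in>D. 0 \<le> d) \<and> (\<forall>w. (\<forall>d\<in>D. w \<le> d) \<longrightarrow> w \<le> 0)"
  by (auto simp: isGlb_def greatestP_def isLb_def setge_def setle_def)

text \<open>A lower bound \<open>w\<close> of nonnegative elements can be replaced by
  \<open>pprt w\<close>, so it suffices to exclude strictly positive lower bounds.\<close>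

lemma isGlb_0I:
  fixes D :: "'a::vector_lattice set"
  assumes nonneg: "\<And>d. d \<in> D \<Longrightarrow> 0 \<le> d"
    and pos: "\<And>w. 0 < w \<Longrightarrow> (\<And>d. d \<in> D \<Longrightarrow> w \<le> d) \<Longrightarrow> False"
  shows "isGlb UNIV D 0"
  unfolding isGlb_0_iff
proof (intro conjI ballI allI impI)
  fix w assume w: "\<forall>d\<in>D. w \<le> d"
  show "w \<le> 0"
  proof (rule ccontr)
    assume "\<not> w \<le> 0"
    then have "0 < pprt w"
      by (simp add: pprt_pos_iff)
    moreover have "pprt w \<le> d" if "d \<in> D" for d
      using that w nonneg by (simp add: pprt_le_iff)
    ultimately show False
      using pos by blast
  qed
qed (use nonneg in auto)

lemma of_nat_scaleR_Suc: "of_nat (Suc n) *\<^sub>R x = x + of_nat n *\<^sub>R (x::'a::real_vector)"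
  by (simp add: scaleR_left_distrib)

lemma inf_of_nat_scaleR_eq_0:
  fixes x y :: "'a::vector_lattice"
  assumes "0 \<le> x" "0 \<le> y" "inf x y = 0"
  shows "inf x (of_nat n *\<^sub>R y) = 0"
proof (induction n)
  case (Suc n)
  then show ?case
    unfolding of_nat_scaleR_Suc
    using assms by (intro inf_add_eq_0) (auto intro: scaleR_nonneg_nonneg)
qed (use assms in \<open>simp add: inf_absorb2\<close>)

lemma inverse_of_nat_scaleR_le:
  fixes x y :: "'a::ordered_real_vector"
  assumes "x \<le> of_nat k *\<^sub>R y" "0 < k"
  shows "(1 / of_nat k) *\<^sub>R x \<le> y"
  using assms scaleR_left_mono[OF assms(1), of "1 / of_nat k"] by simp

lemma scaleR_pos:
  fixes x :: "'a::ordered_real_vector"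
  assumes "0 < c" "0 < x"
  shows "0 < c *\<^sub>R x"
  using assms scaleR_nonneg_nonneg[of c x] by (auto simp: less_le)

lemma archimedean_le_0:
  fixes x y :: "'a::archimedean_vector_lattice"
  assumes "\<And>n::nat. of_nat n *\<^sub>R x \<le> y"
  shows "x \<le> 0"
  using archimedean[of x y] assms by blast

text \<open>If the positive multiples of \<open>x\<close> are bounded, their supremum exists. The
  set of these multiples is closed under adding \<open>x\<close>, so the supremum absorbs a further
  \<open>x\<close>.\<close>

instance dedekind_complete_vector_lattice \<subseteq> archimedean_vector_lattice
proof
  fix x y :: 'a
  assume le: "\<And>n::nat. 0 < n \<Longrightarrow> of_nat n *\<^sub>R x \<le> y"
  define M where "M = (\<lambda>n::nat. of_nat (Suc n) *\<^sub>R x) ` UNIV"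
  have M: "bdd_above M" "M \<noteq> {}"
    using le unfolding M_def bdd_above_def by blast+
  have "Sup M \<le> Sup M - x"
  proof (rule cSup_least[OF M(2)])
    fix z assume "z \<in> M"
    then obtain n where "z = of_nat (Suc n) *\<^sub>R x"
      by (auto simp: M_def)
    then have "x + z = of_nat (Suc (Suc n)) *\<^sub>R x"
      by (simp only: of_nat_scaleR_Suc)
    then have "x + z \<in> M"
      unfolding M_def by blast
    then show "z \<le> Sup M - x"
      using cSup_upper[OF _ M(1)] by (simp add: le_diff_eq add.commute)
  qed
  then show "x \<le> 0"
    by simp
qed

text \<open>Let \<open>r\<close> be the infimum in question. Each \<open>t\<close> in
  \<open>T\<close> is disjoint from \<open>r\<close>, so \<open>t + r = sup t r \<le> Sup T\<close>;
  thus \<open>Sup T - r\<close> is still an upper bound and \<open>r\<close> vanishes.\<close>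

lemma inf_cSup_eq_0:
  fixes z :: "'a::dedekind_complete_vector_lattice"
  assumes "T \<noteq> {}" "bdd_above T" "\<And>t. t \<in> T \<Longrightarrow> 0 \<le> t" "0 \<le> z"
    and disj: "\<And>t. t \<in> T \<Longrightarrow> inf z t = 0"
  shows "inf z (Sup T) = 0"
proof -
  define r where "r = inf z (Sup T)"
  have Sup: "t \<le> Sup T" if "t \<in> T" for t
    using cSup_upper[OF that assms(2)] .
  then have "0 \<le> r"
    using assms(1,3,4) unfolding r_def by (meson ex_in_conv le_inf_iff order_trans)
  have "Sup T \<le> Sup T - r"
  proof (rule cSup_least[OF assms(1)])
    fix t assume t: "t \<in> T"
    have "inf t r = 0"
      using inf_eq_0_mono[OF disj[OF t], of r t] \<open>0 \<le> r\<close> assms(3)[OF t]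
      by (simp add: r_def inf_commute)
    then have "t + r \<le> Sup T"
      using Sup[OF t] by (simp add: add_eq_sup_of_inf_eq_0 r_def)
    then show "t \<le> Sup T - r"
      by (simp add: le_diff_eq)
  qed
  then have "r \<le> 0"
    by (simp only: le_diff_eq add_le_same_cancel1)
  then show ?thesis
    using \<open>0 \<le> r\<close> by (auto simp: r_def intro: order.antisym)
qed

text \<open>Here \<open>v\<close> lies below \<open>k x\<close> plus the positive part of
  \<open>v - k x\<close>, and that positive part is disjoint from every multiple of the positive
  part of \<open>k x - v\<close>. It follows later that the component of \<open>v\<close> generated
  by the latter lies below \<open>k x\<close>.\<close>

lemma scaleR_pprt_diff_inf_le:
  fixes x v :: "'a::vector_lattice"
  assumes "0 \<le> x" "0 \<le> v"
  shows "inf (of_nat j *\<^sub>R pprt (of_nat k *\<^sub>R x - v)) v \<le> of_nat k *\<^sub>R x"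
proof -
  let ?p = "of_nat j *\<^sub>R pprt (of_nat k *\<^sub>R x - v)" and ?q = "pprt (v - of_nat k *\<^sub>R x)"
  have "inf ?q ?p = 0"
    by (rule inf_of_nat_scaleR_eq_0) (simp_all only: inf_pprt_diff zero_le_pprt)
  have p0: "0 \<le> ?p"
    by (intro scaleR_nonneg_nonneg) auto
  have kx: "0 \<le> of_nat k *\<^sub>R x"
    using assms by (simp add: scaleR_nonneg_nonneg)
  have "v \<le> of_nat k *\<^sub>R x + ?q"
    using le_pprt[of "v - of_nat k *\<^sub>R x"] by (simp only: diff_le_eq add.commute)
  then have "inf ?p v \<le> inf ?p (of_nat k *\<^sub>R x + ?q)"
    by (intro inf_mono) auto
  also have "\<dots> \<le> inf ?p (of_nat k *\<^sub>R x) + inf ?p ?q"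
    using p0 kx by (intro inf_add_le) auto
  also have "\<dots> \<le> of_nat k *\<^sub>R x"
    using \<open>inf ?q ?p = 0\<close> by (simp add: inf_commute)
  finally show ?thesis .
qed

lemma archimedean_pprt_pos:
  fixes x y :: "'a::archimedean_vector_lattice"
  assumes "0 < x" "0 \<le> y"
  obtains k :: nat where "0 < k" "0 < pprt (of_nat k *\<^sub>R x - y)"
proof (rule ccontr)
  assume "\<not> thesis"
  then have "of_nat k *\<^sub>R x \<le> y" for k :: nat
    using that assms(2) by (cases "k = 0") (auto simp: pprt_diff_pos_iff)
  then have "x \<le> 0"
    by (rule archimedean_le_0)
  with assms(1) show False
    by auto
qed

section \<open>Components\<close>

lemma components_iff:
  fixes u :: "'a::vector_lattice"
  shows "c \<in> components u \<longleftrightarrow> 0 \<le> c \<and> c \<le> u \<and> inf c (u - c) = 0"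
  unfolding components_def using inf_le2[of c "u - c"] by (auto simp only: diff_ge_0_iff_ge)

lemma componentsD:
  fixes u :: "'a::vector_lattice"
  assumes "c \<in> components u"
  shows "0 \<le> c" "c \<le> u" "inf c (u - c) = 0"
  using assms by (auto simp: components_iff)

lemma component_self: "0 \<le> u \<Longrightarrow> u \<in> components (u::'a::vector_lattice)"
  by (simp add: components_iff inf_absorb2)

lemma component_compl: "c \<in> components u \<Longrightarrow> u - c \<in> components (u::'a::vector_lattice)"
  by (auto simp: components_iff inf_commute)

text \<open>The complement \<open>u - inf c d\<close> is at most \<open>(u - c) + (u - d)\<close>,
  and both summands are disjoint from \<open>inf c d\<close>.\<close>

lemma component_inf:
  fixes u :: "'a::vector_lattice"
  assumes "c \<in> components u" "d \<in> components u"
  shows "inf c d \<in> components u"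
proof -
  note c = componentsD[OF assms(1)] and d = componentsD[OF assms(2)]
  have "inf (inf c d) (u - c) = 0"
    using c d by (intro inf_eq_0_mono[OF c(3)]) auto
  moreover have "inf (inf c d) (u - d) = 0"
    using c d by (intro inf_eq_0_mono[OF d(3)]) auto
  ultimately have "inf (inf c d) ((u - c) + (u - d)) = 0"
    using c d by (intro inf_add_eq_0) auto
  moreover have "u - inf c d \<le> (u - c) + (u - d)"
  proof -
    have "sup c d \<le> u" using c d by simp
    then have "c + d - inf c d \<le> u"
      by (simp only: add_eq_inf_sup[of c d] add_diff_cancel_right')
    then have "(c + d - inf c d) + (u - c - d) \<le> u + (u - c - d)"
      by (rule add_right_mono)
    moreover have "(c + d - inf c d) + (u - c - d) = u - inf c d" "u + (u - c - d) = (u - c) + (u - d)"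
      by (simp_all only: diff_conv_add_uminus ac_simps) (simp_all add: algebra_simps)
    ultimately show ?thesis
      by simp
  qed
  moreover have nonneg: "0 \<le> inf c d" and le: "inf c d \<le> u"
    using c d by (simp_all add: le_infI1)
  moreover have "0 \<le> u - inf c d"
    using le by (simp only: diff_ge_0_iff_ge)
  ultimately have "inf (inf c d) (u - inf c d) = 0"
    using inf_eq_0_mono order.refl by blast
  with nonneg le show ?thesis
    by (simp only: components_iff)
qed

text \<open>Below \<open>u\<close>, disjointness from \<open>c\<close> turns into domination by the
  complement because \<open>w = inf w (c + (u - c))\<close> splits subadditively.\<close>

lemma component_disjoint_iff:
  fixes u :: "'a::vector_lattice"
  assumes c: "c \<in> components u" and w: "0 \<le> w" "w \<le> u"
  shows "inf w c = 0 \<longleftrightarrow> w \<le> u - c"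
proof
  assume "inf w c = 0"
  have "w = inf w (c + (u - c))"
    using w by (simp add: inf_absorb1)
  also have "\<dots> \<le> inf w c + inf w (u - c)"
    using componentsD[OF c] w by (intro inf_add_le) auto
  finally show "w \<le> u - c"
    using \<open>inf w c = 0\<close> by simp
next
  assume "w \<le> u - c"
  moreover have "inf (u - c) c = 0"
    using componentsD(3)[OF c] by (simp only: inf_commute)
  ultimately show "inf w c = 0"
    using inf_eq_0_mono w(1) componentsD(1)[OF c] order.refl by blast
qed

lemma component_le_iff:
  fixes u :: "'a::vector_lattice"
  assumes c: "c \<in> components u" and w: "0 \<le> w" "w \<le> u"
  shows "w \<le> c \<longleftrightarrow> inf w (u - c) = 0"
  using component_disjoint_iff[OF component_compl[OF c] w] by simp

text \<open>The projection of \<open>u\<close> onto the band generated by \<open>w\<close>.\<close>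

definition component_of :: "'a::dedekind_complete_vector_lattice \<Rightarrow> 'a \<Rightarrow> 'a" where
  "component_of u w = Sup (range (\<lambda>n::nat. inf (of_nat n *\<^sub>R w) u))"

context
  fixes u w :: "'a::dedekind_complete_vector_lattice"
  assumes u: "0 \<le> u" and w: "0 \<le> w"
begin

lemma bdd_above_component_of: "bdd_above (range (\<lambda>n::nat. inf (of_nat n *\<^sub>R w) u))"
  by (rule bdd_aboveI[of _ u]) auto

lemma scaleR_inf_le_component_of: "inf (of_nat n *\<^sub>R w) u \<le> component_of u w"
  unfolding component_of_def by (rule cSup_upper[OF _ bdd_above_component_of]) blast

lemma inf_le_component_of: "inf w u \<le> component_of u w"
  using scaleR_inf_le_component_of[of 1] by simp

lemma component_of_leI:
  "(\<And>n. inf (of_nat n *\<^sub>R w) u \<le> z) \<Longrightarrow> component_of u w \<le> z"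
  unfolding component_of_def by (rule cSup_least) auto

lemma component_of_disjoint:
  assumes "0 \<le> z" "inf z w = 0"
  shows "inf z (component_of u w) = 0"
  unfolding component_of_def
proof (rule inf_cSup_eq_0[OF _ bdd_above_component_of])
  fix t assume "t \<in> range (\<lambda>n::nat. inf (of_nat n *\<^sub>R w) u)"
  then obtain n :: nat where t: "t = inf (of_nat n *\<^sub>R w) u"
    by blast
  then show "0 \<le> t"
    using u w by (simp add: scaleR_nonneg_nonneg)
  then show "inf z t = 0"
    using t u w assms by (intro inf_eq_0_mono[OF inf_of_nat_scaleR_eq_0[OF assms(1) w assms(2), of n]]) auto
qed (use assms in auto)

text \<open>The overlap \<open>t\<close> of \<open>w\<close> with \<open>u - ?c\<close> can be added
  to any truncation \<open>inf (n w) u\<close> without leaving the next truncation. Hence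
  \<open>?c + t \<le> ?c\<close>, so \<open>u - ?c\<close> is disjoint from \<open>w\<close> and
  therefore from the supremum \<open>?c\<close>.\<close>

lemma component_of_in_components: "component_of u w \<in> components u"
proof -
  let ?c = "component_of u w"
  have c0: "0 \<le> ?c"
    using scaleR_inf_le_component_of[of 0] u by (simp add: inf_absorb1)
  have cu: "?c \<le> u"
    by (rule component_of_leI) simp
  define t where "t = inf w (u - ?c)"
  have "?c \<le> ?c - t"
  proof (rule component_of_leI)
    fix n :: nat
    have "inf (of_nat n *\<^sub>R w) u + t \<le> of_nat n *\<^sub>R w + w"
      by (intro add_mono) (auto simp: t_def)
    moreover have "inf (of_nat n *\<^sub>R w) u + t \<le> ?c + (u - ?c)"
      using scaleR_inf_le_component_of by (intro add_mono) (auto simp: t_def)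
    ultimately have "inf (of_nat n *\<^sub>R w) u + t \<le> inf (of_nat (Suc n) *\<^sub>R w) u"
      by (simp add: scaleR_left_distrib add.commute)
    also have "\<dots> \<le> ?c"
      by (rule scaleR_inf_le_component_of)
    finally show "inf (of_nat n *\<^sub>R w) u \<le> ?c - t"
      by (simp add: le_diff_eq)
  qed
  moreover have "0 \<le> t"
    using w cu by (simp add: t_def)
  ultimately have "t = 0"
    by simp
  then have "inf (u - ?c) ?c = 0"
    using cu by (intro component_of_disjoint) (auto simp: t_def inf_commute)
  then show ?thesis
    using c0 cu by (simp add: components_iff inf_commute)
qed

lemma component_of_le_component:
  assumes "d \<in> components u" "w \<le> d"
  shows "component_of u w \<le> d"
proof -
  have "inf w (u - d) = 0"
    using assms component_le_iff[OF assms(1) w] componentsD[OF assms(1)] by auto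
  then have "inf (component_of u w) (u - d) = 0"
    using component_of_disjoint[of "u - d"] componentsD[OF assms(1)] by (simp add: inf_commute)
  then show ?thesis
    using component_le_iff[OF assms(1)] componentsD[OF component_of_in_components] by blast
qed

end

section \<open>Countable \<open>\<pi>\<close>-bases of component algebras\<close>

definition inf_closed :: "'a::inf set \<Rightarrow> bool" where
  "inf_closed E \<longleftrightarrow> (\<forall>d\<in>E. \<forall>e\<in>E. inf d e \<in> E)"

lemma component_of_pos_le_components:
  fixes u :: "'a::dedekind_complete_vector_lattice"
  assumes u: "0 \<le> u" and w: "0 < w" "w \<le> u"
  shows "0 < component_of u w" "w \<le> component_of u w"
proof -
  show "w \<le> component_of u w"
    using inf_le_component_of[OF u, of w] w by (simp add: inf_absorb1)
  with w(1) show "0 < component_of u w"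
    by (rule less_le_trans)
qed

text \<open>Since \<open>inf a e = 0\<close> means \<open>e \<le> u - a\<close>, the separation
  assumption says that some complement \<open>u - a\<close> dominates a member of \<open>E\<close>
  without dominating \<open>x\<close>. It is the trace of order null sets on the component algebra
  of \<open>u\<close>.\<close>

locale separating_components =
  fixes u :: "'a::dedekind_complete_vector_lattice" and A :: "'a set"
  assumes u: "0 \<le> u"
    and A: "countable A" "A \<subseteq> components u"
    and separating: "\<And>E x. E \<subseteq> components u \<Longrightarrow> E \<noteq> {} \<Longrightarrow> inf_closed E \<Longrightarrow> isGlb UNIV E 0 \<Longrightarrow>
      x \<in> components u \<Longrightarrow> 0 < x \<Longrightarrow> \<exists>a\<in>A. \<exists>e\<in>E. inf a e = 0 \<and> inf a x \<noteq> 0"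
begin

definition pi_base_below :: "'a \<Rightarrow> bool" where
  "pi_base_below y \<longleftrightarrow> y \<in> components u \<and> 0 < y \<and>
     (\<forall>z\<in>components u. 0 < z \<and> z \<le> y \<longrightarrow> (\<exists>a\<in>A. 0 < inf a y \<and> inf a y \<le> z))"

lemma A_component: "a \<in> A \<Longrightarrow> a \<in> components u"
  using A by blast

text \<open>
  If the claim fails at \<open>x\<close>, then a filter base in the component algebra that is maximal among
  those whose members meet every \<open>a \<in> A\<close> meeting \<open>x\<close> has infimum \<open>0\<close>: a nonzero component
  \<open>y\<close> below all of its members could be thinned out without losing this property.
\<close>

lemma exists_pi_base_below:
  assumes x: "x \<in> components u" "0 < x"
  shows "\<exists>y. pi_base_below y \<and> y \<le> x"
proof (rule ccontr)
  assume "\<not> ?thesis"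
  then have bad: "\<exists>z\<in>components u. 0 < z \<and> z \<le> y \<and> (\<forall>a\<in>A. 0 < inf a y \<longrightarrow> \<not> inf a y \<le> z)"
    if "y \<in> components u" "0 < y" "y \<le> x" for y
    using that \<open>\<not> (\<exists>y. pi_base_below y \<and> y \<le> x)\<close> unfolding pi_base_below_def by blast
  define \<E> where "\<E> = {E. E \<subseteq> components u \<and> x \<in> E \<and> inf_closed E \<and>
    (\<forall>e\<in>E. \<forall>a\<in>A. inf a x \<noteq> 0 \<longrightarrow> inf a e \<noteq> 0)}"
  have "\<exists>M\<in>\<E>. \<forall>E\<in>\<E>. M \<subseteq> E \<longrightarrow> E = M"
  proof (rule subset_Zorn_nonempty)
    have "{x} \<in> \<E>"
      using x by (auto simp: \<E>_def inf_closed_def)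
    then show "\<E> \<noteq> {}"
      by blast
    fix C assume "C \<noteq> {}" and chain: "subset.chain \<E> C"
    then have sub: "C \<subseteq> \<E>" and lin: "\<And>E E'. E \<in> C \<Longrightarrow> E' \<in> C \<Longrightarrow> E \<subseteq> E' \<or> E' \<subseteq> E"
      by (auto simp: subset_chain_def)
    have "inf_closed (\<Union>C)"
      unfolding inf_closed_def
    proof (intro ballI)
      fix d e assume "d \<in> \<Union>C" "e \<in> \<Union>C"
      then obtain E where "E \<in> C" "d \<in> E" "e \<in> E"
        using lin by blast
      then show "inf d e \<in> \<Union>C"
        using sub unfolding \<E>_def inf_closed_def by blast
    qed
    then show "\<Union>C \<in> \<E>"
      using sub \<open>C \<noteq> {}\<close> unfolding \<E>_def by blast
  qed
  then obtain E where E: "E \<in> \<E>" and max: "\<And>E'. E' \<in> \<E> \<Longrightarrow> E \<subseteq> E' \<Longrightarrow> E' = E"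
    by blast
  from E have comp: "e \<in> components u" if "e \<in> E" for e
    using that by (auto simp: \<E>_def)
  from E have "x \<in> E" and cl: "inf_closed E"
    and meet: "\<And>e a. e \<in> E \<Longrightarrow> a \<in> A \<Longrightarrow> inf a x \<noteq> 0 \<Longrightarrow> inf a e \<noteq> 0"
    by (auto simp: \<E>_def)
  have "isGlb UNIV E 0"
  proof (rule isGlb_0I)
    show "\<And>d. d \<in> E \<Longrightarrow> 0 \<le> d"
      using componentsD(1) comp by blast
    fix w assume w: "0 < w" "\<And>d. d \<in> E \<Longrightarrow> w \<le> d"
    define y where "y = component_of u w"
    have "w \<le> u"
      using w(2)[OF \<open>x \<in> E\<close>] componentsD(2)[OF x(1)] by (rule order_trans)
    then have y: "0 < y" "y \<in> components u"
      unfolding y_def using component_of_pos_le_components(1)[OF u w(1)]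
        component_of_in_components[OF u less_imp_le[OF w(1)]] by auto
    have y_le: "y \<le> e" if "e \<in> E" for e
      unfolding y_def
      using component_of_le_component[OF u less_imp_le[OF w(1)] comp[OF that] w(2)[OF that]] .
    then obtain z where z: "z \<in> components u" "0 < z" "z \<le> y"
      and thin: "\<And>a. a \<in> A \<Longrightarrow> 0 < inf a y \<Longrightarrow> \<not> inf a y \<le> z"
      using bad[OF y(2,1)] \<open>x \<in> E\<close> by blast
    \<comment> \<open>If \<open>a\<close> missed the thinned member, then
      \<open>inf a e \<le> z \<le> y\<close>. The trace \<open>inf a y\<close> would then lie below
      \<open>z\<close> and vanish by the choice of \<open>z\<close>, forcing
      \<open>inf a e = 0\<close>.\<close>
    have meets: "inf a (inf e (u - z)) \<noteq> 0" if e: "e \<in> E" and a: "a \<in> A" "inf a x \<noteq> 0" for a e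
    proof
      assume 0: "inf a (inf e (u - z)) = 0"
      note comps = componentsD[OF A_component[OF a(1)]] componentsD[OF comp[OF e]]
      have "0 \<le> inf a e" "inf a e \<le> u"
        using comps by (simp_all add: le_infI1)
      moreover have "inf (inf a e) (u - z) = 0"
        using 0 by (simp only: inf_assoc)
      ultimately have ae: "inf a e \<le> z"
        using component_le_iff[OF z(1)] by blast
      have "inf a y \<le> inf a e"
        using y_le[OF e] by (intro inf_mono) auto
      then have "inf a y \<le> z"
        using ae by (rule order_trans)
      then have "inf a y = 0"
        using thin[OF a(1)] comps(1) y(1) by (metis inf_greatest less_le)
      moreover have "inf a e \<le> inf a y"
        using ae z(3) by (auto intro: order_trans)
      ultimately have "inf a e = 0"
        using \<open>0 \<le> inf a e\<close> by (simp add: order.antisym)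
      then show False
        using meet[OF e a] by blast
    qed
    define E' where "E' = E \<union> (\<lambda>e. inf e (u - z)) ` E"
    have inf1: "inf (inf d (u - z)) (inf e (u - z)) = inf (inf d e) (u - z)"
      "inf d (inf e (u - z)) = inf (inf d e) (u - z)"
      "inf (inf d (u - z)) e = inf (inf d e) (u - z)" for d e
      by (simp_all only: inf_aci inf_idem)
    have "inf_closed E'"
      unfolding inf_closed_def
    proof (intro ballI)
      fix d e assume "d \<in> E'" "e \<in> E'"
      then obtain d' e' where d': "d' \<in> E" "d = d' \<or> d = inf d' (u - z)"
        and e': "e' \<in> E" "e = e' \<or> e = inf e' (u - z)"
        unfolding E'_def by blast
      have "inf d' e' \<in> E"
        using d' e' cl by (auto simp: inf_closed_def)
      moreover have "inf d e = inf d' e' \<or> inf d e = inf (inf d' e') (u - z)"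
        using d'(2) e'(2) by (elim disjE) (simp_all only: inf1[of d' e'] simp_thms)
      ultimately show "inf d e \<in> E'"
        unfolding E'_def by (simp only: Un_iff image_iff) metis
    qed
    moreover have "E' \<subseteq> components u"
      unfolding E'_def using comp component_inf component_compl z(1) by blast
    ultimately have "E' \<in> \<E>"
      using \<open>x \<in> E\<close> meets meet by (auto simp: \<E>_def E'_def)
    \<comment> \<open>Maximality puts the thinned member into \<open>E\<close>, so its lower bound
      \<open>y\<close>, and with it \<open>z\<close>, is disjoint from \<open>z\<close>.\<close>
    then have "inf x (u - z) \<in> E"
      using max[of E'] \<open>x \<in> E\<close> by (auto simp: E'_def)
    then have "y \<le> u - z"
      using y_le by (meson le_inf_iff)
    with z(3) have "z \<le> u - z"
      by (rule order_trans)
    then have "inf z (u - z) = z"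
      by (rule inf_absorb1)
    then show False
      using componentsD(3)[OF z(1)] z(2) by simp
  qed
  moreover have "E \<subseteq> components u" "E \<noteq> {}"
    using comp \<open>x \<in> E\<close> by auto
  ultimately obtain a e where "a \<in> A" "e \<in> E" "inf a e = 0" "inf a x \<noteq> 0"
    using separating[OF _ _ cl _ x] by blast
  then show False
    using meet by blast
qed

text \<open>
  For an uncountable disjoint \<open>Y\<close>, discard the countably many members meeting some \<open>a \<in> A\<close>
  that meets only countably many members. The components dominating all but finitely many of
  the remaining ones contradict the separation property.
\<close>

lemma countable_disjoint_components:
  assumes Y: "Y \<subseteq> components u" "\<And>y. y \<in> Y \<Longrightarrow> 0 < y"
    and disj: "\<And>y z. y \<in> Y \<Longrightarrow> z \<in> Y \<Longrightarrow> y \<noteq> z \<Longrightarrow> inf y z = 0"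
  shows "countable Y"
proof (rule ccontr)
  assume unc: "uncountable Y"
  define N where "N a = {y \<in> Y. inf a y \<noteq> 0}" for a
  define I where "I = Y - (\<Union>a\<in>{a\<in>A. countable (N a)}. N a)"
  have "countable (\<Union>a\<in>{a\<in>A. countable (N a)}. N a)"
    using A(1) by (intro countable_UN) (auto intro: countable_subset[of _ A])
  then have count: "countable (Y - I)"
    unfolding I_def by (rule countable_subset[rotated]) blast
  have "I \<noteq> {}"
    using unc count by (cases "I = {}") auto
  then obtain x where x: "x \<in> I" by blast
  then have xY: "x \<in> Y" by (simp add: I_def)
  define E where "E = {e \<in> components u. finite {y \<in> I. \<not> y \<le> e}}"
  have cu: "u \<in> components u"
    using u by (rule component_self)
  have IY: "I \<subseteq> Y"
    by (auto simp: I_def)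
  then have I: "y \<in> components u" "0 < y" if "y \<in> I" for y
    using that Y by auto
  have uE: "u \<in> E"
  proof -
    have none: "{y \<in> I. \<not> y \<le> u} = {}"
      using I(1) componentsD(2) by blast
    show ?thesis
      unfolding E_def using cu by (simp add: none)
  qed
  have "inf_closed E"
    unfolding inf_closed_def
  proof (intro ballI)
    fix d e assume "d \<in> E" "e \<in> E"
    moreover have "{y \<in> I. \<not> y \<le> inf d e} = {y \<in> I. \<not> y \<le> d} \<union> {y \<in> I. \<not> y \<le> e}"
      by auto
    ultimately show "inf d e \<in> E"
      by (simp add: E_def component_inf)
  qed
  \<comment> \<open>For \<open>y\<close> in \<open>I\<close>, the complement \<open>u - y\<close>
    dominates all other members of \<open>I\<close>, so it lies in \<open>E\<close> and a lower
    bound \<open>w\<close> is disjoint from \<open>y\<close>. Then the complement of the component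
    generated by \<open>w\<close> dominates all of \<open>I\<close> and lies in \<open>E\<close>,
    hence dominates \<open>w\<close>.\<close>
  moreover have "isGlb UNIV E 0"
  proof (rule isGlb_0I)
    show "\<And>d. d \<in> E \<Longrightarrow> 0 \<le> d"
      using componentsD(1) by (auto simp: E_def)
    fix w assume w: "0 < w" "\<And>d. d \<in> E \<Longrightarrow> w \<le> d"
    have wu: "w \<le> u"
      using w(2)[OF uE] .
    have w0: "0 \<le> w"
      using w(1) by simp
    have "inf y w = 0" if y: "y \<in> I" for y
    proof -
      have "z \<le> u - y" if "z \<in> I" "z \<noteq> y" for z
        using disj[of z y] that y IY component_disjoint_iff[OF I(1)[OF y]] componentsD(1,2) I(1)
        by blast
      then have "{z \<in> I. \<not> z \<le> u - y} \<subseteq> {y}"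
        by blast
      then have "u - y \<in> E"
        unfolding E_def using component_compl[OF I(1)[OF y]] finite_subset by blast
      then have "w \<le> u - y"
        by (rule w(2))
      then show ?thesis
        using component_disjoint_iff[OF I(1)[OF y] w0 wu] by (simp add: inf_commute)
    qed
    then have "inf y (component_of u w) = 0" if "y \<in> I" for y
      using component_of_disjoint[OF u w0] that componentsD(1) I(1) by blast
    moreover have c: "component_of u w \<in> components u"
      using component_of_in_components u w0 by blast
    ultimately have "y \<le> u - component_of u w" if "y \<in> I" for y
      using component_disjoint_iff[OF c] that componentsD(1,2) I(1) by blast
    then have "finite {y \<in> I. \<not> y \<le> u - component_of u w}"
      using not_finite_existsD by blast
    then have "u - component_of u w \<in> E"
      unfolding E_def using component_compl[OF c] by blast
    then have "w \<le> u - component_of u w"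
      by (rule w(2))
    moreover have "w \<le> component_of u w"
      using component_of_pos_le_components u w(1) wu by blast
    ultimately have "w \<le> inf (component_of u w) (u - component_of u w)"
      by (simp only: le_inf_iff)
    then show False
      using componentsD(3)[OF c] w(1) by simp
  qed
  ultimately obtain a e where a: "a \<in> A" "inf a x \<noteq> 0" and e: "e \<in> E" "inf a e = 0"
    using separating[of E x] uE I[OF x] unfolding E_def by blast
  \<comment> \<open>The member \<open>x\<close> was not discarded although \<open>a\<close> meets
    it.\<close>
  have "uncountable (N a)"
    using x a unfolding I_def N_def by blast
  \<comment> \<open>As \<open>a\<close> misses \<open>e\<close>, it misses everything below
    \<open>e\<close>; only the discarded members and the finitely many not below \<open>e\<close>
    remain.\<close>
  moreover have "N a \<subseteq> (Y - I) \<union> {y \<in> I. \<not> y \<le> e}"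
  proof
    fix y assume y: "y \<in> N a"
    have "\<not> y \<le> e"
    proof
      assume "y \<le> e"
      then have "inf a y = 0"
        using y Y A_component[OF a(1)] componentsD(1)
        by (intro inf_eq_0_mono[OF e(2)]) (auto simp: N_def less_imp_le)
      then show False
        using y by (simp add: N_def)
    qed
    then show "y \<in> (Y - I) \<union> {y \<in> I. \<not> y \<le> e}"
      using y by (auto simp: N_def)
  qed
  moreover have "countable ((Y - I) \<union> {y \<in> I. \<not> y \<le> e})"
    using count e(1) by (auto simp: E_def intro: countable_finite)
  ultimately show False
    using countable_subset by blast
qed

text \<open>Take a maximal disjoint family \<open>Y\<close> of components satisfying
  \<open>pi_base_below\<close>. Every nonzero component \<open>x\<close> lies above such a component
  \<open>w\<close>, and by maximality \<open>w\<close> meets some \<open>y\<close> in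
  \<open>Y\<close>; a trace on \<open>y\<close> then fits below \<open>inf y w\<close>.\<close>

lemma has_countable_pi_base_components: "has_countable_pi_base (components u) 0"
proof -
  define \<Y> where "\<Y> = {Y. (\<forall>y\<in>Y. pi_base_below y) \<and> (\<forall>y\<in>Y. \<forall>z\<in>Y. y \<noteq> z \<longrightarrow> inf y z = 0)}"
  have "\<exists>Y\<in>\<Y>. \<forall>Z\<in>\<Y>. Y \<subseteq> Z \<longrightarrow> Z = Y"
  proof (rule subset_Zorn')
    fix C assume "subset.chain \<Y> C"
    then have sub: "C \<subseteq> \<Y>" and lin: "\<And>E E'. E \<in> C \<Longrightarrow> E' \<in> C \<Longrightarrow> E \<subseteq> E' \<or> E' \<subseteq> E"
      by (auto simp: subset_chain_def)
    have "inf y z = 0" if yz: "y \<in> \<Union>C" "z \<in> \<Union>C" "y \<noteq> z" for y z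
    proof -
      obtain E where "E \<in> C" "y \<in> E" "z \<in> E"
        using yz(1,2) lin by blast
      then show ?thesis
        using sub yz(3) unfolding \<Y>_def by blast
    qed
    then show "\<Union>C \<in> \<Y>"
      using sub unfolding \<Y>_def by blast
  qed
  then obtain Y where Y: "Y \<in> \<Y>" and max: "\<And>Z. Z \<in> \<Y> \<Longrightarrow> Y \<subseteq> Z \<Longrightarrow> Z = Y"
    by blast
  have below: "pi_base_below y" if "y \<in> Y" for y
    using that Y by (simp add: \<Y>_def)
  have "countable Y"
    using Y by (intro countable_disjoint_components) (auto simp: \<Y>_def pi_base_below_def)
  define B where "B = (\<lambda>(a, y). inf a y) ` (A \<times> Y) - {0}"
  have "countable B"
    unfolding B_def using A(1) \<open>countable Y\<close> by simp
  moreover have "pi_base (components u) 0 B"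
    unfolding pi_base_def
  proof (intro conjI ballI impI)
    show "B \<subseteq> components u - {0}"
      using below by (auto simp: B_def pi_base_below_def intro!: component_inf dest: A_component)
    fix x assume "x \<in> components u" "0 < x"
    then obtain w where w: "pi_base_below w" "w \<le> x"
      using exists_pi_base_below[OF \<open>x \<in> components u\<close>] by blast
    have w': "w \<in> components u" "0 < w"
      using w by (auto simp: pi_base_below_def)
    have "\<exists>y\<in>Y. inf y w \<noteq> 0"
    proof (rule ccontr)
      assume "\<not> ?thesis"
      then have disj: "inf y w = 0" if "y \<in> Y" for y
        using that by blast
      then have "insert w Y \<in> \<Y>"
        using Y w(1) by (auto simp: \<Y>_def inf_commute)
      then have "w \<in> Y"
        using max by blast
      then show False
        using disj w'(2) by fastforce
    qed
    then obtain y where y: "y \<in> Y" "inf y w \<noteq> 0"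
      by blast
    note good = below[OF y(1), unfolded pi_base_below_def]
    have "inf y w \<in> components u"
      using good w' component_inf by blast
    moreover from this have "0 < inf y w"
      using y(2) componentsD(1) by (metis less_le)
    ultimately obtain a where a: "a \<in> A" "0 < inf a y" "inf a y \<le> inf y w"
      using good by (meson inf_le1)
    then have "inf a y \<in> B"
      using y(1) by (force simp: B_def)
    moreover have "inf a y \<le> x"
      using a(3) w(2) by (meson le_inf_iff order_trans)
    ultimately show "\<exists>a\<in>B. 0 < a \<and> a \<le> x"
      using a(2) by blast
  qed
  ultimately show ?thesis
    unfolding has_countable_pi_base_def by blast
qed

end

section \<open>Order convergence of filters\<close>

text \<open>This eliminates nets. For a convergent net, \<open>D\<close> may be enlarged to all
  eventual bounds, which are nonnegative because the filter is proper. Conversely, a proper filter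
  is the tail filter of the pairs \<open>(y, S)\<close> with \<open>y\<close> in the eventual set
  \<open>S\<close>, directed by shrinking \<open>S\<close>.\<close>

lemma filter_order_conv_iff:
  fixes F :: "'a::vector_lattice filter"
  shows "filter_order_conv F l \<longleftrightarrow>
    F \<noteq> bot \<and> isGlb UNIV {d. \<forall>\<^sub>F y in F. \<bar>y - l\<bar> \<le> d} 0"
    (is "_ \<longleftrightarrow> _ \<and> isGlb UNIV ?D 0")
proof
  assume "filter_order_conv F l"
  then obtain I :: "('a \<times> 'a set) set" and r x D where dir: "upward_directed I r"
    and F: "F = tail_filter I r x" and D: "isGlb UNIV D 0"
    and tail: "\<forall>d\<in>D. \<exists>a\<in>I. \<forall>b. (a, b) \<in> r \<longrightarrow> \<bar>x b - l\<bar> \<le> d"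
    unfolding filter_order_conv_def net_order_conv_def by blast
  have "refl_on I r"
    using dir by (simp add: upward_directed_def preorder_on_def)
  then have nonbot: "F \<noteq> bot"
    unfolding trivial_limit_def F eventually_tail_filter[OF dir] by (blast dest: refl_onD)
  have "D \<subseteq> ?D"
    unfolding F using tail by (auto simp: eventually_tail_filter[OF dir])
  moreover have "0 \<le> d" if d: "d \<in> ?D" for d
  proof -
    obtain y where "\<bar>y - l\<bar> \<le> d"
      using d eventually_happens'[OF nonbot] by blast
    then show ?thesis
      by (rule order_trans[OF abs_ge_zero])
  qed
  ultimately show "F \<noteq> bot \<and> isGlb UNIV ?D 0"
    using nonbot D unfolding isGlb_0_iff by blast
next
  assume *: "F \<noteq> bot \<and> isGlb UNIV ?D 0"
  define K where "K = {(y, S). y \<in> S \<and> (\<forall>\<^sub>F z in F. z \<in> S)}"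
  define q where "q = {(p, p'). p \<in> K \<and> p' \<in> K \<and> snd p' \<subseteq> snd p}"
  have nonempty: "\<exists>z. z \<in> S" if "\<forall>\<^sub>F z in F. z \<in> S" for S
    using that * eventually_happens' by blast
  have dir: "upward_directed K q"
    unfolding upward_directed_def
  proof (intro conjI ballI)
    show "preorder_on K q"
      by (auto simp: preorder_on_def q_def refl_on_def trans_def)
    have "(undefined, UNIV) \<in> K"
      by (auto simp: K_def)
    then show "K \<noteq> {}"
      by blast
  next
    fix p p' assume p: "p \<in> K" "p' \<in> K"
    then have ev: "\<forall>\<^sub>F z in F. z \<in> snd p \<inter> snd p'"
      by (auto simp: K_def eventually_conj_iff)
    then obtain z where "z \<in> snd p \<inter> snd p'"
      using nonempty by blast
    then have "(z, snd p \<inter> snd p') \<in> K"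
      using ev by (auto simp: K_def)
    then show "\<exists>c\<in>K. (p, c) \<in> q \<and> (p', c) \<in> q"
      using p by (intro bexI[of _ "(z, snd p \<inter> snd p')"]) (auto simp: q_def)
  qed
  have tail: "(\<exists>a\<in>K. \<forall>b. (a, b) \<in> q \<longrightarrow> P (fst b)) \<longleftrightarrow> eventually P F" for P
  proof
    assume "\<exists>a\<in>K. \<forall>b. (a, b) \<in> q \<longrightarrow> P (fst b)"
    then obtain y S where S: "(y, S) \<in> K" and P: "\<forall>b. ((y, S), b) \<in> q \<longrightarrow> P (fst b)"
      by auto
    have "P z" if "z \<in> S" for z
      using P[rule_format, of "(z, S)"] S that by (auto simp: q_def K_def)
    with S show "eventually P F"
      by (auto simp: K_def elim: eventually_mono)
  next
    assume P: "eventually P F"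
    then obtain y where y: "P y"
      using nonempty[of "Collect P"] by auto
    then have "(y, Collect P) \<in> K"
      using P by (auto simp: K_def)
    then show "\<exists>a\<in>K. \<forall>b. (a, b) \<in> q \<longrightarrow> P (fst b)"
      by (intro bexI[of _ "(y, Collect P)"]) (auto simp: q_def K_def)
  qed
  have "F = tail_filter K q fst"
    unfolding filter_eq_iff eventually_tail_filter[OF dir] tail by simp
  moreover have "net_order_conv K q fst l"
    unfolding net_order_conv_def
  proof (intro exI conjI ballI)
    show "isGlb UNIV ?D 0" using * by blast
    fix d assume "d \<in> ?D"
    then show "\<exists>a\<in>K. \<forall>b. (a, b) \<in> q \<longrightarrow> \<bar>fst b - l\<bar> \<le> d"
      using tail[of "\<lambda>z. \<bar>z - l\<bar> \<le> d"] by blast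
  qed
  ultimately show "filter_order_conv F l"
    unfolding filter_order_conv_def using dir by blast
qed

lemma eventually_filter_generated:
  assumes "filter_base B"
  shows "eventually P (filter_generated B) \<longleftrightarrow> (\<exists>S\<in>B. \<forall>y\<in>S. P y)"
proof -
  have "eventually P (filter_generated B) \<longleftrightarrow> (\<exists>S\<in>B. eventually P (principal S))"
    unfolding filter_generated_def
    using assms by (intro eventually_INF_base) (auto simp: filter_base_def)
  then show ?thesis
    by (simp add: eventually_principal)
qed

lemma filter_order_conv_generated_iff:
  fixes B :: "'a::vector_lattice set set"
  assumes "filter_base B"
  shows "filter_order_conv (filter_generated B) l \<longleftrightarrow>
    isGlb UNIV {d. \<exists>S\<in>B. \<forall>y\<in>S. \<bar>y - l\<bar> \<le> d} 0"
proof -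
  have "filter_generated B \<noteq> bot"
    unfolding trivial_limit_def eventually_filter_generated[OF assms]
    using assms by (auto simp: filter_base_def)
  then show ?thesis
    unfolding filter_order_conv_iff eventually_filter_generated[OF assms] by simp
qed

section \<open>Coinitial and majorizing sets\<close>

definition coinitial :: "'a::vector_lattice set \<Rightarrow> bool" where
  "coinitial A \<longleftrightarrow> (\<forall>a\<in>A. 0 < a) \<and> (\<forall>x>0. \<exists>a\<in>A. a \<le> x)"

definition majorizing :: "'a::vector_lattice set \<Rightarrow> bool" where
  "majorizing B \<longleftrightarrow> (\<forall>x. \<exists>b\<in>B. x \<le> b)"

lemma exists_pos:
  assumes "\<exists>x::'a::vector_lattice. x \<noteq> 0"
  shows "\<exists>x::'a. 0 < x"
  using assms zero_less_abs_iff by blast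

text \<open>Left endpoints are coinitial and right endpoints majorize; conversely, all pairs of a
  member of \<open>A\<close> and a nonnegative member of \<open>B\<close> give a cover.
  Nontriviality makes the set of pairs nonempty: in the zero lattice every such interval contains
  \<open>0\<close>, so no sequence of them covers the empty set.\<close>

lemma interval_cover_iff:
  assumes nontrivial: "\<exists>x::'a::vector_lattice. x \<noteq> 0"
  shows "(\<exists>a b :: nat \<Rightarrow> 'a. (\<forall>n. 0 \<le> a n \<and> 0 \<le> b n) \<and> {x. 0 \<le> x} - {0} = (\<Union>n. {a n..b n}))
    \<longleftrightarrow> (\<exists>(A :: 'a set) B :: 'a set. countable A \<and> coinitial A \<and> countable B \<and> majorizing B)"
    (is "?L \<longleftrightarrow> ?R")
proof
  assume ?L
  then obtain a b :: "nat \<Rightarrow> 'a" where ab: "\<And>n. 0 \<le> a n" "\<And>n. 0 \<le> b n"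
    and eq: "{x. 0 \<le> x} - {0} = (\<Union>n. {a n..b n})"
    by blast
  \<comment> \<open>Only nonempty intervals count: their left endpoint lies in the union and is
    therefore nonzero.\<close>
  have "coinitial (a ` {n. a n \<le> b n})"
    unfolding coinitial_def
  proof (intro conjI allI impI ballI)
    fix z assume "z \<in> a ` {n. a n \<le> b n}"
    then have "z \<in> (\<Union>n. {a n..b n})"
      by auto
    then show "0 < z"
      unfolding eq[symmetric] by auto
  next
    fix x :: 'a assume "0 < x"
    then have "x \<in> (\<Union>n. {a n..b n})"
      unfolding eq[symmetric] by auto
    then show "\<exists>z\<in>a ` {n. a n \<le> b n}. z \<le> x"
      by (auto intro: order_trans)
  qed
  moreover have "majorizing (range b)"
    unfolding majorizing_def
  proof
    fix x :: 'a
    show "\<exists>z\<in>range b. x \<le> z"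
    proof (cases "x = 0")
      case False
      then have "\<bar>x\<bar> \<in> (\<Union>n. {a n..b n})"
        unfolding eq[symmetric] by auto
      then show ?thesis
        by (auto intro: order_trans[OF abs_ge_self])
    qed (use ab(2) in auto)
  qed
  moreover have "countable (a ` {n. a n \<le> b n})" "countable (range b)"
    by auto
  ultimately show ?R
    by blast
next
  assume ?R
  then obtain A B :: "'a set" where A: "countable A" "coinitial A" and B: "countable B" "majorizing B"
    by blast
  define C where "C = A \<times> {b \<in> B. 0 \<le> b}"
  have "countable C"
    unfolding C_def using A(1) B(1) by simp
  moreover have "C \<noteq> {}"
    using A(2) B(2) exists_pos[OF nontrivial] unfolding C_def coinitial_def majorizing_def by blast
  ultimately have C: "range (from_nat_into C) = C"
    by (rule range_from_nat_into[rotated])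
  define a b where "a n = fst (from_nat_into C n)" and "b n = snd (from_nat_into C n)" for n
  have in_C: "(a n, b n) \<in> C" for n
    unfolding a_def b_def using C by (metis prod.collapse rangeI)
  then have pos: "0 < a n" "0 \<le> b n" for n
    using A(2) by (auto simp: C_def coinitial_def)
  have "{x. 0 \<le> x} - {0} = (\<Union>n. {a n..b n})"
  proof (intro subset_antisym subsetI)
    fix x :: 'a assume "x \<in> {x. 0 \<le> x} - {0}"
    then have x: "0 < x" by auto
    obtain a' where "a' \<in> A" "a' \<le> x"
      using A(2) x by (auto simp: coinitial_def)
    moreover obtain b' where "b' \<in> B" "x \<le> b'"
      using B(2) by (auto simp: majorizing_def)
    ultimately have "(a', b') \<in> C"
      using x by (auto simp: C_def)
    then obtain n where "from_nat_into C n = (a', b')"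
      using C by (metis rangeE)
    then have "x \<in> {a n..b n}"
      using \<open>a' \<le> x\<close> \<open>x \<le> b'\<close> by (simp add: a_def b_def)
    then show "x \<in> (\<Union>n. {a n..b n})"
      by blast
  next
    fix x assume "x \<in> (\<Union>n. {a n..b n})"
    then obtain n where "a n \<le> x"
      by auto
    then show "x \<in> {x. 0 \<le> x} - {0}"
      using pos(1)[of n] by auto
  qed
  then show ?L
    using pos by - (rule exI[of _ a], rule exI[of _ b], simp add: less_imp_le)
qed

section \<open>Generated ideals and majorizing sequences\<close>

lemma abs_scaleR_le:
  fixes x :: "'a::vector_lattice"
  assumes "\<bar>c\<bar> \<le> r"
  shows "\<bar>c *\<^sub>R x\<bar> \<le> r *\<^sub>R \<bar>x\<bar>"
proof -
  have le: "c *\<^sub>R x \<le> r *\<^sub>R \<bar>x\<bar>" if "\<bar>c\<bar> \<le> r" for c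
  proof -
    have "c *\<^sub>R x \<le> \<bar>c\<bar> *\<^sub>R \<bar>x\<bar>"
    proof (cases "0 \<le> c")
      case True
      then show ?thesis
        by (simp add: scaleR_left_mono abs_ge_self)
    next
      case False
      then have "(- c) *\<^sub>R (- x) \<le> (- c) *\<^sub>R \<bar>x\<bar>"
        by (intro scaleR_left_mono) (auto simp: abs_ge_minus_self)
      then show ?thesis
        using False by simp
    qed
    also have "\<dots> \<le> r *\<^sub>R \<bar>x\<bar>"
      using that by (intro scaleR_right_mono) auto
    finally show ?thesis .
  qed
  from le[of c] le[of "- c"] show ?thesis
    using assms by (intro abs_leI) auto
qed

text \<open>The vectors bounded in absolute value by a multiple of some \<open>v n\<close> form an
  ideal containing the sequence. Monotonicity gives closure under sums, since two terms have a
  common later bound.\<close>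

lemma le_scaleR_if_ideal_generated_eq_UNIV:
  fixes v :: "nat \<Rightarrow> 'a::vector_lattice"
  assumes "incseq v" and nonneg: "\<And>n. 0 \<le> v n" and ideal: "ideal_generated (range v) = UNIV"
  shows "\<exists>n k::nat. x \<le> of_nat k *\<^sub>R v n"
proof -
  define T where "T = {x. \<exists>n k::nat. \<bar>x\<bar> \<le> of_nat k *\<^sub>R v n}"
  have "subspace T"
    unfolding subspace_def
  proof (intro conjI ballI allI)
    show "0 \<in> T"
      unfolding T_def by (auto intro!: exI[of _ 0])
  next
    fix x y assume "x \<in> T" "y \<in> T"
    then obtain n k m l :: nat where xy: "\<bar>x\<bar> \<le> of_nat k *\<^sub>R v n" "\<bar>y\<bar> \<le> of_nat l *\<^sub>R v m"
      unfolding T_def by blast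
    have "\<bar>x + y\<bar> \<le> \<bar>x\<bar> + \<bar>y\<bar>"
      by (rule abs_triangle_ineq)
    also have "\<dots> \<le> of_nat k *\<^sub>R v (max n m) + of_nat l *\<^sub>R v (max n m)"
      using \<open>incseq v\<close> xy
      by (intro add_mono order_trans[OF xy(1)] order_trans[OF xy(2)] scaleR_left_mono)
        (auto simp: incseq_def)
    also have "\<dots> = of_nat (k + l) *\<^sub>R v (max n m)"
      by (simp add: scaleR_left_distrib)
    finally show "x + y \<in> T"
      unfolding T_def by blast
  next
    fix c :: real and x assume "x \<in> T"
    then obtain n k :: nat where x: "\<bar>x\<bar> \<le> of_nat k *\<^sub>R v n"
      unfolding T_def by blast
    obtain l :: nat where l: "\<bar>c\<bar> \<le> of_nat l"
      using real_arch_simple by blast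
    then have "\<bar>c *\<^sub>R x\<bar> \<le> of_nat l *\<^sub>R \<bar>x\<bar>"
      by (rule abs_scaleR_le)
    also have "\<dots> \<le> of_nat l *\<^sub>R (of_nat k *\<^sub>R v n)"
      using x by (intro scaleR_left_mono) auto
    also have "\<dots> = of_nat (l * k) *\<^sub>R v n"
      by simp
    finally show "c *\<^sub>R x \<in> T"
      unfolding T_def by blast
  qed
  then have "riesz_ideal T"
    unfolding riesz_ideal_def T_def by (blast intro: order_trans)
  moreover have "range v \<subseteq> T"
  proof
    fix x assume "x \<in> range v"
    then obtain n where "x = v n"
      by blast
    then have "\<bar>x\<bar> \<le> of_nat 1 *\<^sub>R v n"
      using nonneg by simp
    then show "x \<in> T"
      unfolding T_def by blast
  qed
  ultimately have "ideal_generated (range v) \<subseteq> T"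
    unfolding ideal_generated_def by (intro hull_minimal) auto
  then obtain n k :: nat where "\<bar>x\<bar> \<le> of_nat k *\<^sub>R v n"
    using ideal unfolding T_def by blast
  then have "x \<le> of_nat k *\<^sub>R v n"
    using abs_ge_self by (rule order_trans[rotated])
  then show ?thesis
    by blast
qed

lemma majorizing_iff_ideal_generated:
  "(\<exists>B :: 'a::vector_lattice set. countable B \<and> majorizing B) \<longleftrightarrow>
    (\<exists>v :: nat \<Rightarrow> 'a. incseq v \<and> (\<forall>n. 0 \<le> v n) \<and> ideal_generated (range v) = UNIV)"
    (is "?L \<longleftrightarrow> ?R")
proof
  assume ?L
  then obtain B :: "'a set" where B: "countable B" "majorizing B"
    by blast
  then have "B \<noteq> {}"
    by (auto simp: majorizing_def)
  \<comment> \<open>Partial sums of absolute values make the enumeration of \<open>B\<close>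
    increasing while still dominating each of its terms.\<close>
  define v where "v n = (\<Sum>i\<le>n. \<bar>from_nat_into B i\<bar>)" for n
  have nonneg: "0 \<le> v n" for n
    unfolding v_def by (intro sum_nonneg) auto
  have "incseq v"
    by (rule incseq_SucI) (simp add: v_def)
  moreover have "x \<in> ideal_generated (range v)" for x
    unfolding ideal_generated_def hull_def
  proof (intro InterI, clarify)
    fix T assume T: "riesz_ideal T" "range v \<subseteq> T"
    obtain b where "b \<in> B" "\<bar>x\<bar> \<le> b"
      using B(2) by (auto simp: majorizing_def)
    then obtain n where "\<bar>x\<bar> \<le> from_nat_into B n"
      using from_nat_into_surj[OF B(1)] by metis
    also have "\<dots> \<le> \<bar>from_nat_into B n\<bar>"
      by (rule abs_ge_self)
    also have "\<dots> \<le> v n"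
      unfolding v_def using sum_mono2[of "{..n}" "{n}" "\<lambda>i. \<bar>from_nat_into B i\<bar>"] by simp
    finally have "\<bar>x\<bar> \<le> \<bar>v n\<bar>"
      using nonneg by simp
    then show "x \<in> T"
      using T unfolding riesz_ideal_def by blast
  qed
  ultimately show ?R
    using nonneg by blast
next
  assume ?R
  then obtain v :: "nat \<Rightarrow> 'a" where v: "incseq v" "\<And>n. 0 \<le> v n"
    and ideal: "ideal_generated (range v) = UNIV"
    by blast
  have "majorizing ((\<lambda>(k, n). of_nat k *\<^sub>R v n) ` (UNIV :: (nat \<times> nat) set))"
    unfolding majorizing_def
  proof
    fix x
    obtain n k :: nat where "x \<le> of_nat k *\<^sub>R v n"
      using le_scaleR_if_ideal_generated_eq_UNIV[OF v ideal] by blast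
    then show "\<exists>b\<in>(\<lambda>(k, n). of_nat k *\<^sub>R v n) ` (UNIV :: (nat \<times> nat) set). x \<le> b"
      by force
  qed
  moreover have "countable ((\<lambda>(k, n). of_nat k *\<^sub>R v n) ` (UNIV :: (nat \<times> nat) set))"
    by simp
  ultimately show ?L
    by blast
qed

section \<open>Strong first countability from countable coinitial and majorizing sets\<close>

text \<open>The intervals around \<open>x\<close> whose radius lies in \<open>G\<close> and is an
  eventual bound of \<open>F\<close> generate a coarser filter than \<open>F\<close>. The point is
  that these radii still have infimum \<open>0\<close>, by an Archimedean argument.\<close>

lemma strongly_first_countableI:
  fixes A B :: "'a::archimedean_vector_lattice set"
  assumes nontrivial: "\<exists>x::'a. x \<noteq> 0"
    and A: "countable A" "coinitial A" and B: "countable B" "majorizing B"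
  shows "strongly_first_countable (filter_order_conv :: 'a filter \<Rightarrow> 'a \<Rightarrow> bool)"
  unfolding strongly_first_countable_def
proof
  fix x :: 'a
  define E0 where "E0 = (\<lambda>(b, a, k::nat). b - of_nat k *\<^sub>R a) ` (B \<times> A \<times> UNIV)"
  \<comment> \<open>Finite infima keep the set of radii countable and make the selected intervals a
    filter base.\<close>
  define G where "G = Inf_fin ` {T. finite T \<and> T \<subseteq> E0 \<and> T \<noteq> {}}"
  define S where "S e = {y. \<bar>y - x\<bar> \<le> e}" for e
  have "countable E0"
    unfolding E0_def using A(1) B(1) by simp
  then have "countable {T. finite T \<and> T \<subseteq> E0}"
    by (rule countable_Collect_finite_subset)
  then have "countable G"
    unfolding G_def by (intro countable_image) (auto elim: countable_subset[rotated])
  have "inf_closed G"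
    unfolding inf_closed_def
  proof (intro ballI)
    fix d e assume "d \<in> G" "e \<in> G"
    then obtain T U where T: "d = Inf_fin T" "finite T" "T \<subseteq> E0" "T \<noteq> {}"
      and U: "e = Inf_fin U" "finite U" "U \<subseteq> E0" "U \<noteq> {}"
      unfolding G_def by blast
    then have "inf d e = Inf_fin (T \<union> U)"
      by (simp add: Inf_fin.union)
    then show "inf d e \<in> G"
      using T U unfolding G_def by blast
  qed
  have E0G: "E0 \<subseteq> G"
  proof
    fix e assume "e \<in> E0"
    then show "e \<in> G"
      unfolding G_def by (intro image_eqI[of _ _ "{e}"]) auto
  qed
  show "\<exists>H. countable H \<and> (\<forall>F. filter_order_conv F x \<longrightarrow>
    (\<exists>B. filter_base B \<and> B \<subseteq> {S. \<forall>\<^sub>F y in F. y \<in> S} \<inter> H \<and> filter_order_conv (filter_generated B) x))"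
  proof (rule exI[of _ "S ` G"], intro conjI allI impI)
    show "countable (S ` G)"
      using \<open>countable G\<close> by simp
    fix F assume "filter_order_conv F x"
    define D where "D = {d. \<forall>\<^sub>F y in F. \<bar>y - x\<bar> \<le> d}"
    have D: "isGlb UNIV D 0"
      using \<open>filter_order_conv F x\<close> by (simp add: filter_order_conv_iff D_def)
    then have D0: "0 \<le> d" if "d \<in> D" for d
      using that by (simp add: isGlb_0_iff)
    have D_inf: "inf d e \<in> D" if "d \<in> D" "e \<in> D" for d e
      using that by (simp add: D_def eventually_conj_iff)
    have D_up: "e \<in> D" if "d \<in> D" "d \<le> e" for d e
      using that unfolding D_def by (auto elim!: eventually_mono intro: order_trans)
    define E where "E = G \<inter> D"
    obtain z :: 'a where "0 < z"
      using exists_pos[OF nontrivial] by blast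
    then obtain d0 where d0: "d0 \<in> D"
      using D unfolding isGlb_0_iff by (metis leD)
    obtain b where b: "b \<in> B" "d0 \<le> b"
      using B(2) by (auto simp: majorizing_def)
    have in_E0: "b - of_nat k *\<^sub>R a \<in> E0" if "a \<in> A" for a and k :: nat
      unfolding E0_def using that b(1) by force
    have "E \<noteq> {}"
    proof -
      obtain a where "a \<in> A"
        using A(2) \<open>0 < z\<close> by (auto simp: coinitial_def)
      from in_E0[OF this, of 0] have "b \<in> E"
        using E0G D_up[OF d0 b(2)] by (auto simp: E_def)
      then show ?thesis
        by blast
    qed
    have "inf_closed E"
      using \<open>inf_closed G\<close> D_inf by (auto simp: E_def inf_closed_def)
    have E: "isGlb UNIV E 0"
    proof (rule isGlb_0I)
      show "\<And>d. d \<in> E \<Longrightarrow> 0 \<le> d"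
        using D0 by (simp add: E_def)
      fix w assume w: "0 < w" "\<And>d. d \<in> E \<Longrightarrow> w \<le> d"
      then obtain d1 where "d1 \<in> D" "\<not> w \<le> d1"
        using D unfolding isGlb_0_iff by (metis leD)
      \<comment> \<open>Since \<open>d0 \<le> b\<close>, cutting \<open>d1\<close> down by
        \<open>d0\<close> gives \<open>d \<le> b\<close>, the start of the induction below.\<close>
      define d where "d = inf d1 d0"
      have d: "d \<in> D" "\<not> w \<le> d" "d \<le> b"
        using D_inf[OF \<open>d1 \<in> D\<close> d0] \<open>\<not> w \<le> d1\<close> b(2) by (auto simp: d_def intro: le_infI2)
      then obtain a where a: "a \<in> A" "a \<le> pprt (w - d)"
        using A(2) unfolding coinitial_def pprt_diff_pos_iff[symmetric] by blast
      \<comment> \<open>If \<open>d\<close> lies below the radius \<open>b - k a\<close>, that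
        radius belongs to \<open>E\<close> and so also dominates \<open>w\<close>. It then dominates
        \<open>sup w d\<close>, which is at least \<open>a + d\<close>, so one more \<open>a\<close>
        can be subtracted.\<close>
      have "of_nat k *\<^sub>R a \<le> b - d" for k :: nat
      proof (induction k)
        case (Suc k)
        then have le: "d \<le> b - of_nat k *\<^sub>R a"
          by (simp add: le_diff_eq add.commute)
        then have "b - of_nat k *\<^sub>R a \<in> E"
          using E0G in_E0[OF a(1)] D_up[OF d(1)] by (auto simp: E_def)
        then have "sup w d \<le> b - of_nat k *\<^sub>R a"
          using le w(2) by simp
        moreover have "a + d \<le> sup w d"
          using a(2) by (simp only: pprt_diff_eq le_diff_eq)
        ultimately have "a + d \<le> b - of_nat k *\<^sub>R a"
          by (rule order_trans[rotated])
        then show ?case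
          unfolding of_nat_scaleR_Suc by (simp add: le_diff_eq ac_simps)
      qed (use d(3) in simp)
      then have "a \<le> 0"
        by (rule archimedean_le_0)
      then show False
        using A(2) a(1) by (auto simp: coinitial_def)
    qed
    have "filter_base (S ` E)"
      unfolding filter_base_def
    proof (intro conjI ballI)
      show "S ` E \<noteq> {}"
        using \<open>E \<noteq> {}\<close> by simp
      have "x \<in> S e" if "e \<in> E" for e
        using that D0 by (simp add: S_def E_def)
      then show "{} \<notin> S ` E"
        by blast
      fix P Q assume "P \<in> S ` E" "Q \<in> S ` E"
      then obtain d e where "d \<in> E" "e \<in> E" "P = S d" "Q = S e"
        by blast
      then show "\<exists>U\<in>S ` E. U \<subseteq> P \<inter> Q"
        using \<open>inf_closed E\<close> unfolding inf_closed_def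
        by (intro bexI[of _ "S (inf d e)"] imageI) (auto simp: S_def)
    qed
    moreover have "S ` E \<subseteq> {S. \<forall>\<^sub>F y in F. y \<in> S} \<inter> S ` G"
      by (auto simp: E_def D_def S_def)
    moreover have "filter_order_conv (filter_generated (S ` E)) x"
      unfolding filter_order_conv_generated_iff[OF \<open>filter_base (S ` E)\<close>] isGlb_0_iff
    proof (intro conjI ballI allI impI)
      fix d assume "d \<in> {d. \<exists>U\<in>S ` E. \<forall>y\<in>U. \<bar>y - x\<bar> \<le> d}"
      then obtain e where e: "e \<in> E" "\<forall>y\<in>S e. \<bar>y - x\<bar> \<le> d"
        by blast
      have "x \<in> S e"
        using e(1) D0 by (simp add: S_def E_def)
      then show "0 \<le> d"
        using e(2) by fastforce
    next
      fix w assume "\<forall>d\<in>{d. \<exists>U\<in>S ` E. \<forall>y\<in>U. \<bar>y - x\<bar> \<le> d}. w \<le> d"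
      then have "\<forall>e\<in>E. w \<le> e"
        by (auto simp: S_def)
      then show "w \<le> 0"
        using E by (simp add: isGlb_0_iff)
    qed
    ultimately show "\<exists>B. filter_base B \<and> B \<subseteq> {S. \<forall>\<^sub>F y in F. y \<in> S} \<inter> S ` G \<and>
        filter_order_conv (filter_generated B) x"
      by blast
  qed
qed

section \<open>Bands\<close>

lemma abs_eq_pprt: "\<bar>x\<bar> = pprt x + pprt (- x)" for x :: "'a::lattice_ab_group_add_abs"
  unfolding abs_prts pprt_neg by (rule diff_conv_add_uminus)

definition disjoint_complement :: "'a::vector_lattice set \<Rightarrow> 'a set" where
  "disjoint_complement A = {y. \<forall>a\<in>A. inf \<bar>y\<bar> \<bar>a\<bar> = 0}"

text \<open>Closure under real scalars reduces to natural multiples, by solidity and a natural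
  number above the absolute value of the scalar.\<close>

lemma riesz_ideal_disjoint_complement: "riesz_ideal (disjoint_complement A)"
proof -
  let ?S = "disjoint_complement A"
  have solid: "y \<in> ?S" if x: "x \<in> ?S" and le: "\<bar>y\<bar> \<le> \<bar>x\<bar>" for x y
    unfolding disjoint_complement_def
  proof (intro CollectI ballI)
    fix a assume "a \<in> A"
    then have "inf \<bar>x\<bar> \<bar>a\<bar> = 0"
      using x by (simp add: disjoint_complement_def)
    then show "inf \<bar>y\<bar> \<bar>a\<bar> = 0"
      by (rule inf_eq_0_mono[OF _ abs_ge_zero le abs_ge_zero order.refl])
  qed
  have add: "x + y \<in> ?S" if "x \<in> ?S" "y \<in> ?S" for x y
    unfolding disjoint_complement_def
  proof (intro CollectI ballI)
    fix a assume "a \<in> A"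
    then have "inf \<bar>a\<bar> \<bar>x\<bar> = 0" "inf \<bar>a\<bar> \<bar>y\<bar> = 0"
      using that by (simp_all add: disjoint_complement_def inf_commute)
    then have "inf \<bar>a\<bar> (\<bar>x\<bar> + \<bar>y\<bar>) = 0"
      by (intro inf_add_eq_0) auto
    then have "inf \<bar>a\<bar> \<bar>x + y\<bar> = 0"
      by (rule inf_eq_0_mono[OF _ abs_ge_zero order.refl abs_ge_zero abs_triangle_ineq])
    then show "inf \<bar>x + y\<bar> \<bar>a\<bar> = 0"
      by (simp only: inf_commute)
  qed
  have zero: "0 \<in> ?S"
    by (simp add: disjoint_complement_def inf_absorb1)
  have "c *\<^sub>R x \<in> ?S" if "x \<in> ?S" for c x
  proof -
    obtain n :: nat where "\<bar>c\<bar> \<le> of_nat n"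
      using real_arch_simple by blast
    then have "\<bar>c *\<^sub>R x\<bar> \<le> of_nat n *\<^sub>R \<bar>x\<bar>"
      by (rule abs_scaleR_le)
    also have "\<dots> = \<bar>of_nat n *\<^sub>R \<bar>x\<bar>\<bar>"
      by (intro abs_of_nonneg[symmetric] scaleR_nonneg_nonneg) auto
    finally have le: "\<bar>c *\<^sub>R x\<bar> \<le> \<bar>of_nat n *\<^sub>R \<bar>x\<bar>\<bar>" .
    have "of_nat n *\<^sub>R \<bar>x\<bar> \<in> ?S" for n :: nat
    proof (induction n)
      case (Suc n)
      have "\<bar>x\<bar> \<in> ?S"
        using solid[OF that] by simp
      then show ?case
        unfolding of_nat_scaleR_Suc using Suc by (rule add)
    qed (use zero in simp)
    then show ?thesis
      using solid le by blast
  qed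
  with add zero have "subspace ?S"
    by (simp add: subspace_def)
  with solid show ?thesis
    unfolding riesz_ideal_def by blast
qed

text \<open>The negative part of a supremum \<open>s\<close> lies below the absolute value of any
  member of \<open>T\<close>. The overlap \<open>t\<close> of the positive part with
  \<open>\<bar>a\<bar>\<close> can be subtracted from \<open>s\<close> without losing an upper bound
  of \<open>T\<close>, so it vanishes.\<close>

lemma band_disjoint_complement: "band (disjoint_complement (A :: 'a::vector_lattice set))"
  unfolding band_def
proof (intro conjI allI impI riesz_ideal_disjoint_complement)
  fix T s assume "T \<subseteq> disjoint_complement A \<and> isLub UNIV T (s :: 'a)"
  then have T: "T \<subseteq> disjoint_complement A" and ub: "\<And>y. y \<in> T \<Longrightarrow> y \<le> s"
    and least: "\<And>u. (\<And>y. y \<in> T \<Longrightarrow> y \<le> u) \<Longrightarrow> s \<le> u"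
    by (auto simp: isLub_def leastP_def isUb_def setle_def setge_def)
  show "s \<in> disjoint_complement A"
  proof (cases "T = {}")
    \<comment> \<open>A supremum of the empty set would be a least element, and
      \<open>s \<le> s + s\<close> then forces it to be \<open>0\<close>.\<close>
    case True
    then have "s \<le> u" for u
      using least by blast
    from this[of "s + s"] this[of 0] have "0 \<le> s" "s \<le> 0"
      by (simp_all only: le_add_same_cancel1)
    then have "s = 0"
      by (rule order.antisym[rotated])
    then show ?thesis
      by (simp add: disjoint_complement_def inf_absorb1)
  next
    case False
    then obtain y0 where y0: "y0 \<in> T"
      by blast
    show ?thesis
      unfolding disjoint_complement_def
    proof (intro CollectI ballI)
      fix a assume "a \<in> A"
      then have disj: "inf \<bar>y\<bar> \<bar>a\<bar> = 0" if "y \<in> T" for y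
        using T that by (auto simp: disjoint_complement_def)
      let ?q = "pprt (- s)"
      define t where "t = inf (pprt s) \<bar>a\<bar>"
      have t: "0 \<le> t" "t \<le> pprt s" "t \<le> \<bar>a\<bar>"
        by (simp_all add: t_def)
      have "?q \<le> \<bar>y0\<bar>"
        using order_trans[OF le_imp_neg_le[OF ub[OF y0]] abs_ge_minus_self] by (simp add: pprt_le_iff)
      then have q: "inf \<bar>a\<bar> ?q = 0"
        using inf_eq_0_mono[OF disj[OF y0], of ?q "\<bar>a\<bar>"] by (simp add: inf_commute)
      have "inf t ?q = 0"
        using inf_eq_0_mono[OF q, of t ?q] t by simp
      then have tq: "t + ?q = sup t ?q"
        by (rule add_eq_sup_of_inf_eq_0)
      have s: "pprt s - ?q = s"
        using prts[of s] by (simp add: pprt_neg)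
      \<comment> \<open>Both \<open>y + t\<close> and \<open>y + ?q\<close> lie below
        \<open>pprt s\<close>. Disjointness makes \<open>t + ?q\<close> the supremum of
        \<open>t\<close> and \<open>?q\<close>, so both can be added at once.\<close>
      have "s \<le> s - t"
      proof (rule least)
        fix y assume y: "y \<in> T"
        have "pprt y \<le> \<bar>y\<bar>"
          by (simp add: pprt_le_iff abs_ge_self)
        then have "inf (pprt y) t = 0"
          using inf_eq_0_mono[OF disj[OF y], of "pprt y" t] t by simp
        then have "pprt y + t \<le> pprt s"
          using pprt_mono[OF ub[OF y]] t(2) by (simp add: add_eq_sup_of_inf_eq_0)
        then have "y + t \<le> pprt s"
          using add_right_mono[OF le_pprt[of y], of t] by (rule order_trans[rotated])
        then have "t \<le> pprt s - y"
          by (simp add: le_diff_eq add.commute)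
        moreover have "y \<le> pprt s - ?q"
          unfolding s by (rule ub[OF y])
        then have "?q \<le> pprt s - y"
          by (simp only: le_diff_eq add.commute)
        ultimately have "t + ?q \<le> pprt s - y"
          unfolding tq by (rule sup_least)
        then have "y \<le> (pprt s - ?q) - t"
          by (simp only: le_diff_eq ac_simps)
        then show "y \<le> s - t"
          unfolding s .
      qed
      then have "t \<le> 0"
        by (simp only: le_diff_eq add_le_same_cancel1)
      then have "t = 0"
        using t(1) by (rule order.antisym)
      then have "inf \<bar>a\<bar> (pprt s) = 0"
        by (simp only: t_def inf_commute)
      then have "inf \<bar>a\<bar> \<bar>s\<bar> = 0"
        unfolding abs_eq_pprt[of s] using q by (intro inf_add_eq_0) auto
      then show "inf \<bar>s\<bar> \<bar>a\<bar> = 0"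
        by (simp only: inf_commute)
    qed
  qed
qed

lemma band_Inter:
  assumes "\<And>S. S \<in> C \<Longrightarrow> band (S :: 'a::vector_lattice set)"
  shows "band (\<Inter>C)"
proof -
  have "subspace (\<Inter>C)"
    using assms by (intro subspace_Inter) (auto simp: band_def riesz_ideal_def)
  moreover have "y \<in> \<Inter>C" if "x \<in> \<Inter>C" "\<bar>y\<bar> \<le> \<bar>x\<bar>" for x y
    using that assms unfolding band_def riesz_ideal_def by blast
  moreover have "s \<in> \<Inter>C" if "T \<subseteq> \<Inter>C" "isLub UNIV T s" for T s
  proof
    fix S assume "S \<in> C"
    then have "T \<subseteq> S" "band S"
      using that(1) assms by auto
    then show "s \<in> S"
      using that(2) unfolding band_def by blast
  qed
  ultimately show ?thesis
    unfolding band_def riesz_ideal_def by blast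
qed

lemma band_solid: "band S \<Longrightarrow> x \<in> S \<Longrightarrow> \<bar>y\<bar> \<le> \<bar>x\<bar> \<Longrightarrow> y \<in> S"
  by (simp add: band_def riesz_ideal_def)

lemma band_exists_pos:
  assumes "band S" "S \<noteq> {0}"
  shows "\<exists>x\<in>S. 0 < x"
proof -
  obtain x where x: "x \<in> S" "x \<noteq> 0"
    using assms least_band(2) by blast
  then have "\<bar>x\<bar> \<in> S"
    using band_solid[OF assms(1)] by simp
  then show ?thesis
    using x(2) zero_less_abs_iff by blast
qed

text \<open>The principal bands \<open>g a\<close> serve: a nonzero band contains some
  \<open>x > 0\<close>, and by solidity also any \<open>a \<le> x\<close> from
  \<open>A\<close>.\<close>

lemma has_countable_pi_base_bands:
  fixes A :: "'a::vector_lattice set"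
  assumes A: "countable A" "coinitial A"
  shows "has_countable_pi_base {S :: 'a set. band S} {0}"
proof -
  define g where "g a = \<Inter>{S. band S \<and> a \<in> S}" for a :: 'a
  have band_g: "band (g a)" for a
    unfolding g_def by (rule band_Inter) blast
  have g: "g a \<noteq> {0}" "{0} \<subset> g a" if "a \<in> A" for a
  proof -
    have "a \<in> g a" "a \<noteq> 0"
      using that A(2) by (auto simp: g_def coinitial_def)
    then show "g a \<noteq> {0}"
      by blast
    then show "{0} \<subset> g a"
      using least_band(2)[OF band_g] by blast
  qed
  have "pi_base {S. band S} {0} (g ` A)"
    unfolding pi_base_def
  proof (intro conjI ballI impI)
    show "g ` A \<subseteq> {S. band S} - {{0}}"
      using band_g g by blast
    fix S :: "'a set" assume "S \<in> {S. band S}" "{0} < S"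
    then have S: "band S" "S \<noteq> {0}"
      by auto
    then obtain x where x: "x \<in> S" "0 < x"
      using band_exists_pos by blast
    obtain a where a: "a \<in> A" "a \<le> x" "0 < a"
      using A(2) x(2) unfolding coinitial_def by blast
    then have "a \<in> S"
      using band_solid[OF S(1) x(1)] x(2) by (simp add: less_imp_le)
    then have "g a \<subseteq> S"
      using S(1) by (auto simp: g_def)
    with g(2)[OF a(1)] have "{0} < g a \<and> g a \<le> S"
      by simp
    then show "\<exists>T\<in>g ` A. {0} < T \<and> T \<le> S"
      using a(1) by (rule bexI[OF _ imageI])
  qed
  moreover have "countable (g ` A)"
    using A(1) by simp
  ultimately show ?thesis
    unfolding has_countable_pi_base_def by blast
qed

section \<open>Coinitial sets from \<pi>-bases of bands and of components\<close>

text \<open>For \<open>0 < x \<le> b\<close>, choose \<open>k\<close> such that the positive part of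
  \<open>k x - b\<close> is nonzero, and a member \<open>S\<close> of the \<pi>-base inside the
  double disjoint complement of that part. On this band \<open>b\<close> lies below
  \<open>k x\<close>, so \<open>inf (s S) b\<close> divided by \<open>k\<close> lies below
  \<open>x\<close>.\<close>

lemma coinitial_of_pi_base_bands:
  fixes B :: "'a::archimedean_vector_lattice set"
  assumes B: "countable B" "majorizing B"
    and pi: "has_countable_pi_base {S :: 'a set. band S} {0}"
  shows "\<exists>A :: 'a set. countable A \<and> coinitial A"
proof -
  obtain P :: "'a set set" where P: "countable P" "pi_base {S. band S} {0} P"
    using pi unfolding has_countable_pi_base_def by blast
  then have "\<exists>x\<in>S. 0 < x" if "S \<in> P" for S
    using that band_exists_pos unfolding pi_base_def by blast
  then obtain s where s: "\<And>S. S \<in> P \<Longrightarrow> s S \<in> S" "\<And>S. S \<in> P \<Longrightarrow> 0 < s S"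
    by metis
  \<comment> \<open>Since \<open>1 / 0 = 0\<close>, the index \<open>k = 0\<close> only yields
    \<open>0\<close>; the intersection drops it together with vanishing infima.\<close>
  define A where "A = (\<lambda>(S, b, k::nat). (1 / of_nat k) *\<^sub>R inf (s S) b) ` (P \<times> B \<times> UNIV) \<inter> {a. 0 < a}"
  have "countable A"
    unfolding A_def using P(1) B(1) by (intro countable_Int1 countable_image countable_SIGMA) auto
  moreover have "coinitial A"
    unfolding coinitial_def
  proof (intro conjI ballI allI impI)
    fix x :: 'a assume x: "0 < x"
    obtain b where b: "b \<in> B" "x \<le> b"
      using B(2) by (auto simp: majorizing_def)
    have "0 \<le> b"
      using x b(2) by (meson less_imp_le order_trans)
    then obtain k :: nat where k: "0 < k" "0 < pprt (of_nat k *\<^sub>R x - b)"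
      using archimedean_pprt_pos[OF x] by blast
    let ?p = "pprt (of_nat k *\<^sub>R x - b)" and ?q = "pprt (b - of_nat k *\<^sub>R x)"
    have kx: "0 \<le> of_nat k *\<^sub>R x"
      using x by (simp add: scaleR_nonneg_nonneg less_imp_le)
    define W where "W = disjoint_complement (disjoint_complement {?p})"
    have "band W"
      unfolding W_def by (rule band_disjoint_complement)
    moreover have "?p \<in> W"
      by (auto simp: W_def disjoint_complement_def inf_commute)
    moreover have "?p \<noteq> 0"
      using k(2) by simp
    ultimately have "{0} < W"
      using least_band(2)[OF \<open>band W\<close>] by (metis psubsetI singletonD)
    then obtain S where S: "S \<in> P" "S \<subseteq> W"
      using P(2) \<open>band W\<close> unfolding pi_base_def by (metis mem_Collect_eq)
    let ?s = "s S"
    note s0 = s(2)[OF S(1)]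
    have sW: "?s \<in> W"
      using s(1)[OF S(1)] S(2) by blast
    have W: "inf y z = 0" if "y \<in> W" "0 \<le> y" "0 \<le> z" "inf z ?p = 0" for y z
    proof -
      have "z \<in> disjoint_complement {?p}"
        using that(3,4) by (simp add: disjoint_complement_def)
      then have "inf \<bar>y\<bar> \<bar>z\<bar> = 0"
        using that(1) unfolding W_def disjoint_complement_def[of "disjoint_complement _"] by blast
      then show ?thesis
        using that(2,3) by simp
    qed
    \<comment> \<open>Otherwise \<open>?s\<close> is disjoint from \<open>x\<close>, hence from
      \<open>?p\<close>; lying in the double complement of \<open>?p\<close>, it would be disjoint
      from itself.\<close>
    have "inf ?s b \<noteq> 0"
    proof
      assume "inf ?s b = 0"
      then have "inf ?s x = 0"
        using inf_eq_0_mono[of ?s b ?s x] b(2) s0 x by (simp add: less_imp_le)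
      then have "inf ?s (of_nat k *\<^sub>R x) = 0"
        using s0 x by (intro inf_of_nat_scaleR_eq_0) auto
      then have "inf ?s ?p = 0"
        using inf_eq_0_mono[of ?s "of_nat k *\<^sub>R x" ?s ?p] pprt_diff_le[OF kx \<open>0 \<le> b\<close>] s0
        by (simp add: less_imp_le)
      then have "inf ?s ?s = 0"
        using W[OF sW, of ?s] s0 by simp
      then show False
        using s0 by simp
    qed
    moreover have "0 \<le> inf ?s b"
      using s0 \<open>0 \<le> b\<close> by simp
    ultimately have pos: "0 < inf ?s b"
      by (simp add: less_le)
    have "inf ?s b \<le> of_nat k *\<^sub>R x"
    proof -
      \<comment> \<open>The excess \<open>r\<close> lies below \<open>?q\<close> and so is disjoint
        from \<open>?p\<close>, hence from \<open>?s\<close>; it also lies below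
        \<open>?s\<close>.\<close>
      define r where "r = pprt (inf ?s b - of_nat k *\<^sub>R x)"
      have r: "0 \<le> r" "r \<le> ?s" "r \<le> ?q"
        using pprt_diff_le[OF \<open>0 \<le> inf ?s b\<close> kx]
        by (auto simp: r_def intro!: pprt_mono diff_right_mono)
      have "inf ?q ?p = 0"
        by (rule inf_pprt_diff)
      then have "inf r ?p = 0"
        using inf_eq_0_mono[of ?q ?p r ?p] r by simp
      then have "inf ?s r = 0"
        using W[OF sW _ r(1)] s0 by simp
      then have "r = 0"
        using r(2) by (simp add: inf_absorb2)
      then show ?thesis
        by (simp add: r_def flip: le_zero_iff_zero_pprt)
    qed
    then have "(1 / of_nat k) *\<^sub>R inf ?s b \<le> x"
      using inverse_of_nat_scaleR_le k(1) by blast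
    moreover have "(1 / of_nat k) *\<^sub>R inf ?s b \<in> A"
      using S(1) b(1) k(1) scaleR_pos[OF _ pos, of "1 / of_nat k"] unfolding A_def by force
    ultimately show "\<exists>a\<in>A. a \<le> x"
      by blast
  qed (auto simp: A_def)
  ultimately show ?thesis
    by blast
qed

text \<open>The component of \<open>v n\<close> generated by the positive part of
  \<open>k x - v n\<close> lies below \<open>k x\<close>. It is nonzero because that positive part
  is bounded by a multiple of \<open>v n\<close> and hence cannot be disjoint from it. A member of
  the \<pi>-base below it, divided by \<open>k\<close>, lies below \<open>x\<close>.\<close>

lemma coinitial_of_pi_base_components:
  fixes v :: "nat \<Rightarrow> 'b::dedekind_complete_vector_lattice"
  assumes v: "\<And>n. 0 \<le> v n" and B: "\<And>x. \<exists>n k::nat. x \<le> of_nat k *\<^sub>R v n"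
    and pi: "\<And>n. has_countable_pi_base (components (v n)) 0"
  shows "\<exists>A :: 'b set. countable A \<and> coinitial A"
proof -
  have "\<exists>P. countable P \<and> pi_base (components (v n)) 0 P" for n
    using pi unfolding has_countable_pi_base_def by blast
  then obtain P where P: "\<And>n. countable (P n)" "\<And>n. pi_base (components (v n)) 0 (P n)"
    by metis
  define A where "A = (\<lambda>(k::nat, c). (1 / of_nat k) *\<^sub>R c) ` (UNIV \<times> (\<Union>n. P n)) \<inter> {a. 0 < a}"
  have "countable A"
    unfolding A_def using P(1) by (intro countable_Int1 countable_image countable_SIGMA) auto
  moreover have "coinitial A"
    unfolding coinitial_def
  proof (intro conjI ballI allI impI)
    fix x :: 'b assume x: "0 < x"
    obtain n m :: nat where xv: "x \<le> of_nat m *\<^sub>R v n"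
      using B by blast
    obtain k :: nat where k: "0 < k" "0 < pprt (of_nat k *\<^sub>R x - v n)"
      using archimedean_pprt_pos[OF x v] by blast
    let ?p = "pprt (of_nat k *\<^sub>R x - v n)" and ?c = "component_of (v n) (pprt (of_nat k *\<^sub>R x - v n))"
    have c: "?c \<in> components (v n)"
      using component_of_in_components[OF v] by simp
    have kx: "0 \<le> of_nat k *\<^sub>R x"
      using x by (simp add: scaleR_nonneg_nonneg less_imp_le)
    have "?c \<noteq> 0"
    proof
      assume "?c = 0"
      then have "inf ?p (v n) \<le> 0"
        using inf_le_component_of[OF v zero_le_pprt] by metis
      then have "inf ?p (v n) = 0"
        by (rule order.antisym) (simp add: v)
      then have "inf ?p (of_nat (k * m) *\<^sub>R v n) = 0"
        using v by (intro inf_of_nat_scaleR_eq_0) auto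
      moreover have "?p \<le> of_nat (k * m) *\<^sub>R v n"
      proof -
        have "?p \<le> of_nat k *\<^sub>R x"
          by (rule pprt_diff_le[OF kx v])
        also have "\<dots> \<le> of_nat k *\<^sub>R (of_nat m *\<^sub>R v n)"
          using xv by (intro scaleR_left_mono) auto
        finally show ?thesis
          by simp
      qed
      ultimately have "?p = 0"
        by (metis inf_absorb1)
      then show False
        using k(2) by simp
    qed
    then have "0 < ?c"
      using componentsD(1)[OF c] by (simp add: less_le)
    then obtain a where a: "a \<in> P n" "0 < a" "a \<le> ?c"
      using P(2)[of n] c unfolding pi_base_def by blast
    have "?c \<le> of_nat k *\<^sub>R x"
      using x v by (intro component_of_leI scaleR_pprt_diff_inf_le) auto
    with a(3) have "a \<le> of_nat k *\<^sub>R x"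
      by (rule order_trans)
    then have "(1 / of_nat k) *\<^sub>R a \<le> x"
      using inverse_of_nat_scaleR_le k(1) by blast
    moreover have "(1 / of_nat k) *\<^sub>R a \<in> A"
      using a(1) k(1) scaleR_pos[OF _ a(2), of "1 / of_nat k"] unfolding A_def by force
    ultimately show "\<exists>a\<in>A. a \<le> x"
      by blast
  qed (auto simp: A_def)
  ultimately show ?thesis
    by blast
qed

section \<open>The Dedekind completion\<close>

text \<open>Equivalently, the \<open>q\<close> that dominate a member of \<open>E\<close> have no
  common positive lower bound; as \<open>E\<close> is nonnegative, their infimum is
  \<open>0\<close>.\<close>

definition separates_null_sets :: "'b::vector_lattice set \<Rightarrow> bool" where
  "separates_null_sets Q \<longleftrightarrow> (\<forall>E x. E \<noteq> {} \<longrightarrow> inf_closed E \<longrightarrow> isGlb UNIV E 0 \<longrightarrow> 0 < x \<longrightarrow>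
     (\<exists>q\<in>Q. \<exists>e\<in>E. e \<le> q \<and> \<not> x \<le> q))"

context
  fixes J :: "'a::archimedean_vector_lattice \<Rightarrow> 'b::dedekind_complete_vector_lattice"
  assumes J: "dedekind_completion J"
begin

lemma completion_linear: "linear J"
  using J by (simp add: dedekind_completion_def)

lemma completion_0: "J 0 = 0"
  using completion_linear by (rule linear_0)

lemma completion_le_iff: "J x \<le> J y \<longleftrightarrow> x \<le> y"
  using J unfolding dedekind_completion_def le_iff_sup by (metis injD)

lemma completion_less_iff: "J x < J y \<longleftrightarrow> x < y"
  by (simp add: less_le_not_le completion_le_iff)

lemma completion_abs: "\<bar>J x\<bar> = J \<bar>x\<bar>"
proof -
  have "J \<bar>x\<bar> = sup (J x) (J (- x))"
    using J unfolding dedekind_completion_def abs_lattice by blast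
  then show ?thesis
    using linear_neg[OF completion_linear, of x] by (simp only: abs_lattice)
qed

lemma completion_pprt: "J (pprt x) = pprt (J x)"
  using J completion_0 unfolding dedekind_completion_def pprt_def by metis

lemma completion_pos: "0 < J x \<longleftrightarrow> 0 < x"
  using completion_less_iff[of 0 x] by (simp only: completion_0)

lemma completion_dense: "0 < y \<Longrightarrow> \<exists>x>0. J x \<le> y"
  using J unfolding dedekind_completion_def by blast

lemma completion_majorizing: "\<exists>x. y \<le> J x"
  using J unfolding dedekind_completion_def by blast

text \<open>Every \<open>e\<close> is the infimum of its upper bounds from the range of
  \<open>J\<close>. If the positive part of \<open>z - e\<close> dominated \<open>J x\<close> with
  \<open>x > 0\<close>, then \<open>J x\<close> could be subtracted from any such upper bound
  indefinitely, against the Archimedean property.\<close>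

lemma completion_le_if_upper:
  assumes upper: "\<And>d. e \<le> J d \<Longrightarrow> z \<le> J d"
  shows "z \<le> e"
proof (rule ccontr)
  assume "\<not> z \<le> e"
  then have "0 < pprt (z - e)"
    by (simp add: pprt_diff_pos_iff)
  then obtain x where x: "0 < x" "J x \<le> pprt (z - e)"
    using completion_dense by blast
  have down: "e \<le> J (d - x)" if "e \<le> J d" for d
  proof -
    have "J x + e \<le> sup z e"
      using x(2) by (simp only: pprt_diff_eq le_diff_eq)
    also have "\<dots> \<le> J d"
      using that upper by simp
    finally show ?thesis
      by (simp add: linear_diff[OF completion_linear] le_diff_eq add.commute)
  qed
  obtain d where d: "e \<le> J d"
    using completion_majorizing by blast
  have "e \<le> J (d - of_nat n *\<^sub>R x)" for n
  proof (induction n)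
    case (Suc n)
    have "d - of_nat (Suc n) *\<^sub>R x = d - of_nat n *\<^sub>R x - x"
      unfolding of_nat_scaleR_Suc by (simp add: algebra_simps)
    then show ?case
      using down[OF Suc] by (simp only:)
  qed (use d in simp)
  then have "of_nat n *\<^sub>R J x \<le> J d - e" for n
    by (simp add: linear_diff[OF completion_linear] linear_scale[OF completion_linear]
        le_diff_eq add.commute)
  then have "J x \<le> 0"
    by (rule archimedean_le_0)
  then show False
    using x(1) completion_pos[of x] by simp
qed

lemma completion_le_if_lower:
  assumes lower: "\<And>v. J v \<le> e \<Longrightarrow> J v \<le> z"
  shows "e \<le> z"
proof -
  have "- z \<le> J d" if "- e \<le> J d" for d
    using lower[of "- d"] that
    by (simp add: linear_neg[OF completion_linear] minus_le_iff)
  then have "- z \<le> - e"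
    by (rule completion_le_if_upper)
  then show ?thesis
    by simp
qed

text \<open>By order density, a positive lower bound in the completion would lie above some
  \<open>J x\<close> with \<open>x > 0\<close>, and \<open>x\<close> would bound \<open>D\<close>
  from below.\<close>

lemma completion_isGlb_0:
  assumes D: "isGlb UNIV D 0"
  shows "isGlb UNIV (J ` D) 0"
proof (rule isGlb_0I)
  show "0 \<le> z" if "z \<in> J ` D" for z
    using that D completion_le_iff[of 0] by (auto simp: isGlb_0_iff completion_0)
  fix w :: 'b assume w: "0 < w" "\<And>z. z \<in> J ` D \<Longrightarrow> w \<le> z"
  obtain x where x: "0 < x" "J x \<le> w"
    using completion_dense[OF w(1)] by blast
  have "x \<le> d" if "d \<in> D" for d
  proof -
    have "J x \<le> J d"
      using x(2) w(2)[OF imageI[OF that]] by (rule order_trans)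
    then show ?thesis
      by (simp only: completion_le_iff)
  qed
  then have "x \<le> 0"
    using D by (simp add: isGlb_0_iff)
  then show False
    using x(1) by simp
qed

text \<open>
  The countable set consists of the suprema of \<open>J |y|\<close> over the bounded members \<open>S\<close> of the given
  countable family at \<open>0\<close>. A downward directed \<open>E\<close> with infimum \<open>0\<close> in the completion yields an
  order null filter, generated by the sets \<open>{y. J |y| \<le> e}\<close>.
\<close>

lemma strongly_first_countable_imp_separates:
  assumes sfc: "strongly_first_countable (filter_order_conv :: 'a filter \<Rightarrow> 'a \<Rightarrow> bool)"
  shows "\<exists>Q :: 'b set. countable Q \<and> separates_null_sets Q"
proof -
  obtain H :: "'a set set" where "countable H"
    and H: "\<And>F. filter_order_conv F 0 \<Longrightarrow> \<exists>B. filter_base B \<and>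
      B \<subseteq> {S. \<forall>\<^sub>F y in F. y \<in> S} \<inter> H \<and> filter_order_conv (filter_generated B) 0"
    using sfc unfolding strongly_first_countable_def by meson
  \<comment> \<open>For an empty or unbounded \<open>S\<close> this value is arbitrary, but the
    image of \<open>H\<close> stays countable; the argument evaluates \<open>q\<close> only at
    nonempty bounded members.\<close>
  define q where "q S = Sup ((\<lambda>y. \<bar>J y\<bar>) ` S)" for S
  have "separates_null_sets (q ` H)"
    unfolding separates_null_sets_def
  proof (intro allI impI)
    fix E :: "'b set" and x :: 'b
    assume E: "E \<noteq> {}" "inf_closed E" "isGlb UNIV E 0" and x: "0 < x"
    have E0: "0 \<le> e" if "e \<in> E" for e
      using that E(3) by (simp add: isGlb_0_iff)
    define W where "W e = {y. \<bar>J y\<bar> \<le> e}" for e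
    have W0: "0 \<in> W e" if "e \<in> E" for e
      using E0[OF that] by (simp add: W_def completion_0)
    have base: "filter_base (W ` E)"
      unfolding filter_base_def
    proof (intro conjI ballI)
      show "W ` E \<noteq> {}" "{} \<notin> W ` E"
        using E(1) W0 by auto
      fix P R assume "P \<in> W ` E" "R \<in> W ` E"
      then obtain d e where de: "d \<in> E" "e \<in> E" "P = W d" "R = W e"
        by blast
      then have "inf d e \<in> E"
        using E(2) by (simp add: inf_closed_def)
      moreover have "W (inf d e) \<subseteq> P \<inter> R"
        using de by (auto simp: W_def)
      ultimately show "\<exists>U\<in>W ` E. U \<subseteq> P \<inter> R"
        by blast
    qed
    have "filter_order_conv (filter_generated (W ` E)) 0"
      unfolding filter_order_conv_generated_iff[OF base] isGlb_0_iff
    proof (intro conjI ballI allI impI)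
      fix d assume "d \<in> {d. \<exists>S\<in>W ` E. \<forall>y\<in>S. \<bar>y - 0\<bar> \<le> d}"
      then show "0 \<le> d"
        using W0 by fastforce
    next
      fix w assume w: "\<forall>d\<in>{d. \<exists>S\<in>W ` E. \<forall>y\<in>S. \<bar>y - 0\<bar> \<le> d}. w \<le> d"
      \<comment> \<open>Elements of \<open>E\<close> need not come from the original lattice, so
        \<open>e\<close> is approached by its upper bounds \<open>J d\<close>; each such
        \<open>d\<close> bounds \<open>W e\<close>.\<close>
      have "J w \<le> e" if "e \<in> E" for e
      proof (rule completion_le_if_upper)
        fix d assume "e \<le> J d"
        then have "\<bar>y - 0\<bar> \<le> d" if "y \<in> W e" for y
          using that completion_le_iff order_trans by (fastforce simp: W_def completion_abs)
        then have "w \<le> d"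
          using w \<open>e \<in> E\<close> by blast
        then show "J w \<le> J d"
          by (simp add: completion_le_iff)
      qed
      then have "J w \<le> J 0"
        using E(3) by (simp add: isGlb_0_iff completion_0)
      then show "w \<le> 0"
        by (simp add: completion_le_iff)
    qed
    then obtain B where B: "filter_base B" "\<And>S. S \<in> B \<Longrightarrow> S \<in> H"
      "\<And>S. S \<in> B \<Longrightarrow> \<forall>\<^sub>F y in filter_generated (W ` E). y \<in> S"
      "filter_order_conv (filter_generated B) 0"
      using H by blast
    define D where "D = {d. \<exists>S\<in>B. \<forall>y\<in>S. \<bar>y - 0\<bar> \<le> d}"
    have "isGlb UNIV (J ` D) 0"
      using B(4) unfolding D_def filter_order_conv_generated_iff[OF B(1)] by (rule completion_isGlb_0)
    moreover have "\<not> x \<le> 0"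
      using x by (simp add: less_le_not_le)
    ultimately obtain d where "d \<in> D" and d: "\<not> x \<le> J d"
      unfolding isGlb_0_iff by blast
    then obtain S where S: "S \<in> B" "\<And>y. y \<in> S \<Longrightarrow> \<bar>y\<bar> \<le> d"
      by (auto simp: D_def)
    have bound: "\<bar>J y\<bar> \<le> J d" if "y \<in> S" for y
      using S(2)[OF that] by (simp add: completion_abs completion_le_iff)
    have "S \<noteq> {}"
      using B(1) S(1) by (auto simp: filter_base_def)
    then have "q S \<le> J d"
      unfolding q_def using bound by (intro cSup_least) auto
    then have "\<not> x \<le> q S"
      using d order_trans by blast
    moreover obtain e where e: "e \<in> E" "W e \<subseteq> S"
      using B(3)[OF S(1)] unfolding eventually_filter_generated[OF base] by blast
    \<comment> \<open>Dually, \<open>e\<close> is approached from below by elements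
      \<open>J v\<close>; passing to \<open>pprt v\<close> gives a member of \<open>W e\<close>,
      hence of \<open>S\<close>.\<close>
    have "e \<le> q S"
    proof (rule completion_le_if_lower)
      fix v assume "J v \<le> e"
      then have "J (pprt v) \<le> e"
        using E0[OF e(1)] by (simp add: completion_pprt pprt_le_iff)
      then have "\<bar>J (pprt v)\<bar> \<le> e"
        by (simp add: completion_pprt)
      then have "pprt v \<in> S"
        using e(2) by (auto simp: W_def)
      then have "\<bar>J (pprt v)\<bar> \<le> q S"
        unfolding q_def using bound by (intro cSup_upper bdd_aboveI[of _ "J d"]) auto
      moreover have "J v \<le> \<bar>J (pprt v)\<bar>"
        by (simp add: completion_pprt le_pprt)
      ultimately show "J v \<le> q S"
        by (rule order_trans[rotated])
    qed
    ultimately show "\<exists>q'\<in>q ` H. \<exists>e\<in>E. e \<le> q' \<and> \<not> x \<le> q'"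
      using e(1) B(2)[OF S(1)] by blast
  qed
  moreover have "countable (q ` H)"
    using \<open>countable H\<close> by simp
  ultimately show ?thesis
    by blast
qed

lemma coinitial_of_completion:
  assumes "countable (A :: 'b set)" "coinitial A"
  shows "\<exists>A :: 'a set. countable A \<and> coinitial A"
proof -
  have "\<exists>x>0. J x \<le> a" if "a \<in> A" for a
    using assms(2) that completion_dense by (simp add: coinitial_def)
  then obtain s where s: "\<And>a. a \<in> A \<Longrightarrow> 0 < s a" "\<And>a. a \<in> A \<Longrightarrow> J (s a) \<le> a"
    by metis
  have "coinitial (s ` A)"
    unfolding coinitial_def
  proof (intro conjI allI impI ballI)
    fix x :: 'a assume "0 < x"
    then obtain a where a: "a \<in> A" "a \<le> J x"
      using assms(2) completion_pos unfolding coinitial_def by blast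
    then have "s a \<le> x"
      using order_trans[OF s(2)[OF a(1)] a(2)] by (simp add: completion_le_iff)
    then show "\<exists>z\<in>s ` A. z \<le> x"
      using a(1) by blast
  qed (use s in auto)
  moreover have "countable (s ` A)"
    using assms(1) by simp
  ultimately show ?thesis
    by blast
qed

lemma majorizing_of_completion:
  assumes "countable (B :: 'b set)" "majorizing B"
  shows "\<exists>B :: 'a set. countable B \<and> majorizing B"
proof -
  obtain s where s: "\<And>b. b \<le> J (s b)"
    using completion_majorizing by metis
  have "majorizing (s ` B)"
    unfolding majorizing_def
  proof
    fix x
    obtain b where b: "b \<in> B" "J x \<le> b"
      using assms(2) by (auto simp: majorizing_def)
    then have "x \<le> s b"
      using order_trans[OF b(2) s] by (simp add: completion_le_iff)
    then show "\<exists>z\<in>s ` B. x \<le> z"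
      using b(1) by blast
  qed
  moreover have "countable (s ` B)"
    using assms(1) by simp
  ultimately show ?thesis
    by blast
qed

end

section \<open>Consequences of a countable separating set\<close>

context
  fixes Q :: "'b::dedekind_complete_vector_lattice set"
  assumes Q: "countable Q" "separates_null_sets Q"
begin

lemma separates:
  assumes "E \<noteq> {}" "inf_closed E" "isGlb UNIV E 0" "0 < x"
  shows "\<exists>q\<in>Q. \<exists>e\<in>E. e \<le> q \<and> \<not> x \<le> q"
  using Q(2) assms unfolding separates_null_sets_def by blast

text \<open>The multiples \<open>\<bar>x\<bar>\<close> divided by \<open>n + 1\<close> decrease to
  \<open>0\<close>, so some \<open>q\<close> dominates one of them, and \<open>(n + 1) q\<close>
  dominates \<open>x\<close>.\<close>

lemma separates_imp_majorizing: "\<exists>B :: 'b set. countable B \<and> majorizing B"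
proof -
  \<comment> \<open>The element \<open>0\<close> covers the case \<open>x = 0\<close>, where there
    is no positive element to separate.\<close>
  define B where "B = insert 0 ((\<lambda>(n::nat, q). of_nat n *\<^sub>R q) ` (UNIV \<times> Q))"
  have "countable B"
    unfolding B_def using Q(1) by simp
  moreover have "\<exists>b\<in>B. x \<le> b" for x
  proof (cases "x = 0")
    case False
    define E where "E = range (\<lambda>n::nat. (1 / of_nat (Suc n)) *\<^sub>R \<bar>x\<bar>)"
    have "inf_closed E"
    proof -
      have mono: "(1 / of_nat (Suc n)) *\<^sub>R \<bar>x\<bar> \<le> (1 / of_nat (Suc m)) *\<^sub>R \<bar>x\<bar>" if "m \<le> n" for m n :: nat
        using that by (intro scaleR_right_mono) (auto simp: frac_le)
      have "inf d e = d \<or> inf d e = e" if de: "d \<in> E" "e \<in> E" for d e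
      proof -
        obtain m n where "d = (1 / of_nat (Suc m)) *\<^sub>R \<bar>x\<bar>" "e = (1 / of_nat (Suc n)) *\<^sub>R \<bar>x\<bar>"
          using de unfolding E_def by blast
        then have "d \<le> e \<or> e \<le> d"
          using mono[of m n] mono[of n m] by (metis linear)
        then show ?thesis
          by (metis inf_absorb1 inf_absorb2)
      qed
      then show ?thesis
        unfolding inf_closed_def by metis
    qed
    moreover have "isGlb UNIV E 0"
    proof (rule isGlb_0I)
      fix w assume w: "0 < w" "\<And>d. d \<in> E \<Longrightarrow> w \<le> d"
      have "of_nat (Suc n) *\<^sub>R w \<le> \<bar>x\<bar>" for n
      proof -
        have "w \<le> (1 / of_nat (Suc n)) *\<^sub>R \<bar>x\<bar>"
          by (rule w(2)) (unfold E_def, rule rangeI)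
        then have "of_nat (Suc n) *\<^sub>R w \<le> of_nat (Suc n) *\<^sub>R ((1 / of_nat (Suc n)) *\<^sub>R \<bar>x\<bar>)"
          by (rule scaleR_left_mono) simp
        then show ?thesis
          by simp
      qed
      then have "of_nat n *\<^sub>R w \<le> \<bar>x\<bar>" for n
        by (cases n) (simp, blast)
      then have "w \<le> 0"
        by (rule archimedean_le_0)
      then show False
        using w(1) by simp
    qed (auto simp: E_def intro!: scaleR_nonneg_nonneg)
    moreover have "E \<noteq> {}"
      by (simp add: E_def)
    ultimately obtain q e where "q \<in> Q" "e \<in> E" "e \<le> q"
      using separates[of E "\<bar>x\<bar>"] False by auto
    then obtain n where "(1 / of_nat (Suc n)) *\<^sub>R \<bar>x\<bar> \<le> q"
      unfolding E_def by blast
    then have "of_nat (Suc n) *\<^sub>R ((1 / of_nat (Suc n)) *\<^sub>R \<bar>x\<bar>) \<le> of_nat (Suc n) *\<^sub>R q"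
      by (intro scaleR_left_mono) auto
    then have "\<bar>x\<bar> \<le> of_nat (Suc n) *\<^sub>R q"
      by simp
    then have "x \<le> of_nat (Suc n) *\<^sub>R q"
      by (rule order_trans[OF abs_ge_self])
    moreover have "of_nat (Suc n) *\<^sub>R q \<in> B"
      unfolding B_def using \<open>q \<in> Q\<close> by (intro insertI2 image_eqI[of _ _ "(Suc n, q)"]) auto
    ultimately show ?thesis
      by blast
  qed (auto simp: B_def)
  ultimately show ?thesis
    unfolding majorizing_def by blast
qed

text \<open>Let \<open>a\<close> be the component generated by the positive part of
  \<open>u - q\<close>. If a component \<open>e\<close> lies below \<open>q\<close>, that part lies
  below \<open>u - e\<close>, so \<open>a\<close> misses \<open>e\<close>. If \<open>x\<close> does
  not lie below \<open>q\<close>, the nonzero positive part of \<open>x - q\<close> lies below both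
  \<open>x\<close> and \<open>a\<close>, so \<open>a\<close> meets \<open>x\<close>.\<close>

lemma separates_imp_pi_base_components:
  fixes u :: 'b
  assumes u: "0 \<le> u"
  shows "has_countable_pi_base (components u) 0"
proof -
  define A where "A = (\<lambda>q. component_of u (pprt (u - q))) ` Q"
  interpret separating_components u A
  proof
    show "0 \<le> u" by fact
    show "countable A"
      unfolding A_def using Q(1) by simp
    show "A \<subseteq> components u"
      unfolding A_def using component_of_in_components[OF u] by auto
    fix E x
    assume E: "E \<subseteq> components u" "E \<noteq> {}" "inf_closed E" "isGlb UNIV E 0"
      and x: "x \<in> components u" "0 < x"
    obtain q e where q: "q \<in> Q" "e \<in> E" "e \<le> q" "\<not> x \<le> q"
      using separates[OF E(2-4) x(2)] by blast
    let ?p = "pprt (u - q)"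
    let ?a = "component_of u ?p"
    have e: "e \<in> components u"
      using E(1) q(2) by blast
    have "?p \<le> u - e"
      using q(3) componentsD(2)[OF e] by (simp add: pprt_le_iff diff_left_mono)
    then have "inf e ?p = 0"
      by (intro inf_eq_0_mono[OF componentsD(3)[OF e]]) (auto simp: componentsD[OF e])
    then have "inf e ?a = 0"
      using component_of_disjoint[OF u] componentsD(1)[OF e] by simp
    moreover have "inf ?a x \<noteq> 0"
    proof
      define r where "r = pprt (x - q)"
      have "0 \<le> q"
        using componentsD(1)[OF e] q(3) by (rule order_trans)
      then have r: "r \<le> x"
        unfolding r_def using x(2) by (intro pprt_diff_le) auto
      have "r \<le> ?p"
        unfolding r_def using componentsD(2)[OF x(1)] by (intro pprt_mono diff_right_mono)
      moreover have "r \<le> u"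
        using r componentsD(2)[OF x(1)] by (rule order_trans)
      ultimately have "r \<le> ?a"
        using inf_le_component_of[OF u, of ?p] by (meson le_infI order_trans zero_le_pprt)
      moreover assume "inf ?a x = 0"
      ultimately have "r \<le> 0"
        using r by (metis le_infI)
      then show False
        using q(4) by (simp add: r_def pprt_le_iff)
    qed
    ultimately show "\<exists>a\<in>A. \<exists>e\<in>E. inf a e = 0 \<and> inf a x \<noteq> 0"
      using q(1,2) unfolding A_def by (metis imageI inf_commute)
  qed
  show ?thesis
    by (rule has_countable_pi_base_components)
qed

end

section \<open>Assembling the equivalences\<close>

theorem theorem4p30:
  fixes J :: "'a::archimedean_vector_lattice \<Rightarrow> 'b::dedekind_complete_vector_lattice"
  assumes nontrivial: "\<exists>x::'a. x \<noteq> 0"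
    and completion: "dedekind_completion J"
  shows
    "let
       cond_i = strongly_first_countable (filter_order_conv :: 'a filter \<Rightarrow> 'a \<Rightarrow> bool);
       cond_ii = (\<exists>a b :: nat \<Rightarrow> 'a. (\<forall>n. 0 \<le> a n \<and> 0 \<le> b n) \<and>
                    {x. 0 \<le> x} - {0} = (\<Union>n. {a n..b n}));
       cond_iii = ((\<exists>v :: nat \<Rightarrow> 'a. incseq v \<and> (\<forall>n. 0 \<le> v n) \<and>
                      ideal_generated (range v) = UNIV) \<and>
                   has_countable_pi_base {S :: 'a set. band S} {0});
       cond_iv = (\<exists>a b :: nat \<Rightarrow> 'b. (\<forall>n. 0 \<le> a n \<and> 0 \<le> b n) \<and>
                    {x. 0 \<le> x} - {0} = (\<Union>n. {a n..b n}));
       cond_v = (\<exists>v :: nat \<Rightarrow> 'b. incseq v \<and> (\<forall>n. 0 \<le> v n) \<and>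
                   ideal_generated (range v) = UNIV \<and>
                   (\<forall>n. has_countable_pi_base (components (v n)) 0))
     in (cond_i \<longleftrightarrow> cond_ii) \<and> (cond_i \<longleftrightarrow> cond_iii) \<and>
        (cond_i \<longleftrightarrow> cond_iv) \<and> (cond_i \<longleftrightarrow> cond_v)"
proof -
  define i where "i \<longleftrightarrow> strongly_first_countable (filter_order_conv :: 'a filter \<Rightarrow> 'a \<Rightarrow> bool)"
  define ii where "ii \<longleftrightarrow> (\<exists>a b :: nat \<Rightarrow> 'a. (\<forall>n. 0 \<le> a n \<and> 0 \<le> b n) \<and>
    {x. 0 \<le> x} - {0} = (\<Union>n. {a n..b n}))"
  define iii where "iii \<longleftrightarrow> (\<exists>v :: nat \<Rightarrow> 'a. incseq v \<and> (\<forall>n. 0 \<le> v n) \<and>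
    ideal_generated (range v) = UNIV) \<and> has_countable_pi_base {S :: 'a set. band S} {0}"
  define iv where "iv \<longleftrightarrow> (\<exists>a b :: nat \<Rightarrow> 'b. (\<forall>n. 0 \<le> a n \<and> 0 \<le> b n) \<and>
    {x. 0 \<le> x} - {0} = (\<Union>n. {a n..b n}))"
  define v where "v \<longleftrightarrow> (\<exists>v :: nat \<Rightarrow> 'b. incseq v \<and> (\<forall>n. 0 \<le> v n) \<and>
    ideal_generated (range v) = UNIV \<and> (\<forall>n. has_countable_pi_base (components (v n)) 0))"
  have nontrivial': "\<exists>y::'b. y \<noteq> 0"
    using exists_pos[OF nontrivial] completion_pos[OF completion] by (metis less_irrefl)
  have ii_iff: "ii \<longleftrightarrow> (\<exists>(A :: 'a set) B :: 'a set. countable A \<and> coinitial A \<and> countable B \<and> majorizing B)"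
    unfolding ii_def by (rule interval_cover_iff[OF nontrivial])
  have iv_iff: "iv \<longleftrightarrow> (\<exists>(A :: 'b set) B :: 'b set. countable A \<and> coinitial A \<and> countable B \<and> majorizing B)"
    unfolding iv_def by (rule interval_cover_iff[OF nontrivial'])
  \<comment> \<open>The implications run in the cycle \<open>i\<close>, \<open>v\<close>,
    \<open>iv\<close>, \<open>ii\<close>, \<open>i\<close>; the equivalence of \<open>ii\<close> and
    \<open>iii\<close> stays within the original lattice and is added separately.\<close>
  have "v" if "i"
  proof -
    obtain Q :: "'b set" where Q: "countable Q" "separates_null_sets Q"
      using strongly_first_countable_imp_separates[OF completion \<open>i\<close>[unfolded i_def]] by blast
    obtain w :: "nat \<Rightarrow> 'b" where "incseq w" "\<forall>n. 0 \<le> w n" "ideal_generated (range w) = UNIV"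
      using separates_imp_majorizing[OF Q] majorizing_iff_ideal_generated by metis
    then show ?thesis
      unfolding v_def using separates_imp_pi_base_components[OF Q] by blast
  qed
  moreover have "iv" if "v"
  proof -
    obtain w :: "nat \<Rightarrow> 'b" where w: "incseq w" "\<And>n. 0 \<le> w n" "ideal_generated (range w) = UNIV"
      and pi: "\<And>n. has_countable_pi_base (components (w n)) 0"
      using \<open>v\<close> unfolding v_def by blast
    have "\<exists>A :: 'b set. countable A \<and> coinitial A"
      using coinitial_of_pi_base_components[OF w(2) le_scaleR_if_ideal_generated_eq_UNIV[OF w] pi] .
    moreover have "\<exists>B :: 'b set. countable B \<and> majorizing B"
      unfolding majorizing_iff_ideal_generated using w by blast
    ultimately show ?thesis
      unfolding iv_iff by blast
  qed
  moreover have "ii" if "iv"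
  proof -
    obtain A B :: "'b set" where "countable A" "coinitial A" "countable B" "majorizing B"
      using \<open>iv\<close> unfolding iv_iff by blast
    then show ?thesis
      unfolding ii_iff
      using coinitial_of_completion[OF completion] majorizing_of_completion[OF completion] by metis
  qed
  moreover have "i" if "ii"
    using \<open>ii\<close> strongly_first_countableI[OF nontrivial] unfolding ii_iff i_def by blast
  moreover have "ii \<longleftrightarrow> iii"
  proof
    assume "ii"
    then obtain A B :: "'a set" where "countable A" "coinitial A" "countable B" "majorizing B"
      unfolding ii_iff by blast
    then show "iii"
      unfolding iii_def using has_countable_pi_base_bands majorizing_iff_ideal_generated by blast
  next
    assume "iii"
    then obtain B :: "'a set" where "countable B" "majorizing B"
      and "has_countable_pi_base {S :: 'a set. band S} {0}"
      unfolding iii_def using majorizing_iff_ideal_generated by blast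
    then show "ii"
      unfolding ii_iff using coinitial_of_pi_base_bands by blast
  qed
  ultimately have "(i \<longleftrightarrow> ii) \<and> (i \<longleftrightarrow> iii) \<and> (i \<longleftrightarrow> iv) \<and> (i \<longleftrightarrow> v)"
    by blast
  then show ?thesis
    unfolding Let_def i_def ii_def iii_def iv_def v_def .
qed

end
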